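(* Let $\phi$ be a random 3CNF formula with $n$ variables and $m = o\left(n^{\frac{3}{2} - \frac{22 \log \log n}{\log n}}\right)$ clauses. Then with high probability (i.e. with probability tending to $1$ as $n \to \infty$), $\vartheta(G_{\phi}^{xor}) = m$.
   Context: A 3CNF formula over variables $x_1,\dots,x_n$ is a collection of $m$ clauses, each consisting of exactly three literals (a literal is a variable $x_i$ or its negation $\bar{x}_i$) over three distinct variables. A random 3CNF formula with $m$ clauses is obtained by choosing each clause independently and uniformly at random from the set of all possible clauses. The graph $G_{\phi}^{xor}$: for each clause of $\phi$ there is a "cloud" of 4 vertices, one for each assignment of truth values to the three literals of the clause under which an odd number of the three literals are true. Two vertices (in the same cloud or in different clouds) are adjacent iff their associated partial assignments are contradicting, i.e. some variable is set to true by one and to false by the other. (Distinct vertices within a cloud are always contradicting, so each cloud is a clique.) $\vartheta(G)$ denotes the Lovász theta function of a graph $G$ on vertex set $\{1,\dots,N\}$; equivalently, it is the maximum of $\sum_{i=1}^N \langle v_0, v_i\rangle$ over vectors $v_0, v_1,\dots,v_N$ in a real inner product space satisfying $\langle v_0,v_0\rangle=1$, $\langle v_i,v_i\rangle = \langle v_i,v_0\rangle$ for all $i\ge 1$, $\langle v_i,v_j\rangle \ge 0$ for all pairs $i,j$, and $\langle v_i,v_j\rangle = 0$ for every edge $(i,j)$ of $G$. *)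

theory Defs
  imports
    "HOL-Probability.Probability"
    "HOL-Library.Landau_Symbols"
    "Jordan_Normal_Form.Matrix"
begin

section \<open>Random 3CNF formulas\<close>

text \<open>\<open>(i, True)\<close> is the literal \<open>x\<^sub>i\<close> and \<open>(i, False)\<close> is its negation.\<close>

type_synonym literal = "nat \<times> bool"
type_synonym clause = "literal set"

definition clauses :: "nat \<Rightarrow> clause set" where
  "clauses n = {C. C \<subseteq> {1..n} \<times> UNIV \<and> card C = 3 \<and> inj_on fst C}"

text \<open>
  A formula with \<open>m\<close> clauses is an indexed family \<open>\<phi> 0, \<dots>, \<phi> (m - 1)\<close>, so that a clause may
  occur several times; \<open>\<phi>\<close> is the dummy value \<open>{}\<close> at all other indices. There are no clauses
  for \<open>n < 3\<close>; the distribution is then meaningless.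
\<close>

definition random_3cnf :: "nat \<Rightarrow> nat \<Rightarrow> (nat \<Rightarrow> clause) pmf" where
  "random_3cnf n m = Pi_pmf {..<m} {} (\<lambda>_. pmf_of_set (clauses n))"

section \<open>The graph of a formula\<close>

text \<open>A graph is a vertex set with a (symmetric) set of ordered pairs of adjacent vertices.\<close>

type_synonym 'a graph = "'a set \<times> ('a \<times> 'a) set"

type_synonym partial_assignment = "nat \<rightharpoonup> bool"

definition true_literals :: "partial_assignment \<Rightarrow> clause \<Rightarrow> literal set" where
  "true_literals a C = {l \<in> C. a (fst l) = Some (snd l)}"

definition xor_assignments :: "clause \<Rightarrow> partial_assignment set" where
  "xor_assignments C = {a. dom a = fst ` C \<and> odd (card (true_literals a C))}"

definition contradicting :: "partial_assignment \<Rightarrow> partial_assignment \<Rightarrow> bool" where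
  "contradicting a b \<longleftrightarrow>
     (\<exists>i. a i = Some True \<and> b i = Some False \<or> a i = Some False \<and> b i = Some True)"

text \<open>
  Vertices carry the index of their clause, so that the clouds of different clauses are disjoint
  even if the clauses have the same variables.
\<close>

definition xor_graph :: "nat \<Rightarrow> (nat \<Rightarrow> clause) \<Rightarrow> (nat \<times> partial_assignment) graph" where
  "xor_graph m \<phi> =
     (let V = (SIGMA k:{..<m}. xor_assignments (\<phi> k))
      in (V, {(u, w). u \<in> V \<and> w \<in> V \<and> contradicting (snd u) (snd w)}))"

section \<open>The theta function\<close>

text \<open>
  The vectors live in \<open>\<real>\<^sup>d\<close> with an arbitrary \<open>d\<close>. For a finite graph this is no restriction:
  finitely many vectors in a real inner product space span a space isometric to some \<open>\<real>\<^sup>d\<close>.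
\<close>

definition theta_feasible :: "'a graph \<Rightarrow> nat \<Rightarrow> real vec \<Rightarrow> ('a \<Rightarrow> real vec) \<Rightarrow> bool" where
  "theta_feasible G d v0 v \<longleftrightarrow>
     v0 \<in> carrier_vec d \<and> (\<forall>i\<in>fst G. v i \<in> carrier_vec d) \<and>
     scalar_prod v0 v0 = 1 \<and>
     (\<forall>i\<in>fst G. scalar_prod (v i) (v i) = scalar_prod (v i) v0) \<and>
     (\<forall>i\<in>fst G. \<forall>j\<in>fst G. scalar_prod (v i) (v j) \<ge> 0) \<and>
     (\<forall>(i, j)\<in>snd G. scalar_prod (v i) (v j) = 0)"

text \<open>For a finite graph the maximum exists by compactness, as \<open>d\<close> can be bounded.\<close>

definition lovasz_theta :: "'a graph \<Rightarrow> real" where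
  "lovasz_theta G =
     (GREATEST t. \<exists>d v0 v. theta_feasible G d v0 v \<and> t = (\<Sum>i\<in>fst G. scalar_prod v0 (v i)))"

end

theory Submission
  imports Defs "HOL-Real_Asymp.Real_Asymp"
begin

text \<open>
  Prepending a point \<open>0\<close> of value \<open>1\<close> to the variables turns every clause into a parity constraint on
  four points. Call two points correlated if a combination of at most \<open>L = \<lceil>ln n\<rceil>\<close> constraints
  determines their product. By a first moment bound, with high probability every set of \<open>s \<le> 2 L + 2\<close>
  clauses covers more than \<open>3 s / 2\<close> variables, and more than \<open>3 s / 2 + 1\<close> if \<open>s > L\<close>. Hence no
  combination of at most \<open>2 L + 2\<close> constraints is trivial, and those that involve at most two points
  consist of at most \<open>L\<close> constraints.
  So correlation is an equivalence relation with consistent signs, giving unit vectors \<open>V\<^sub>p\<close> that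
  are parallel or orthogonal. The vector of an assignment \<open>a\<close> in the cloud of a clause is the mean of
  \<open>a\<^sub>p V\<^sub>p\<close> over its four points. Inner products of such vectors are character sums over a subgroup
  of a product of two Klein four-groups, hence nonnegative, and zero for contradicting assignments.
  The upper bound \<open>m\<close> holds because the graph is covered by \<open>m\<close> cliques.
\<close>

section \<open>Parity constraints and correlated points\<close>

lemma odd_card_sym_diff:
  assumes "finite A" "finite B"
  shows "odd (card (sym_diff A B)) \<longleftrightarrow> odd (card A) \<noteq> odd (card B)"
proof -
  have "card A = card (A - B) + card (A \<inter> B)" "card B = card (B - A) + card (A \<inter> B)"
    using assms by (metis card_Diff_subset_Int card_mono finite_Int inf_le1 le_add_diff_inverse2)
       (metis assms card_Diff_subset_Int card_mono finite_Int inf_commute inf_le1 le_add_diff_inverse2)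
  moreover have "card (sym_diff A B) = card (A - B) + card (B - A)"
    using assms by (intro card_Un_disjoint) auto
  ultimately show ?thesis by presburger
qed

lemma mem_sym_diff: "x \<in> sym_diff A B \<longleftrightarrow> (x \<in> A) \<noteq> (x \<in> B)"
  by blast

text \<open>The boundary computation behind \<open>corr_translate\<close>: every set except
  \<open>E\<close> and \<open>G\<close> occurs exactly twice on the left and so cancels.\<close>

lemma sym_diff_cancel:
  fixes A :: "'a set"
  shows "sym_diff (sym_diff (sym_diff A B) (sym_diff C D))
    (sym_diff (sym_diff (sym_diff E A) (sym_diff C F)) (sym_diff (sym_diff G B) (sym_diff D F)))
    = sym_diff E G"
proof (rule Set.set_eqI)
  fix x
  show "x \<in> sym_diff (sym_diff (sym_diff A B) (sym_diff C D))
    (sym_diff (sym_diff (sym_diff E A) (sym_diff C F)) (sym_diff (sym_diff G B) (sym_diff D F))) \<longleftrightarrow>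
    x \<in> sym_diff E G"
    unfolding mem_sym_diff
    by (cases "x \<in> A"; cases "x \<in> B"; cases "x \<in> C"; cases "x \<in> D"; cases "x \<in> F"; simp)
qed

text \<open>
  Translation by \<open>u\<close> when \<open>Q\<close> is identified with the Klein four-group with neutral element \<open>z\<close>.
\<close>

lemma klein_translation:
  assumes "card Q = 4" "z \<in> Q" "u \<in> Q"
  obtains \<tau> where "bij_betw \<tau> Q Q"
    "\<And>p. p \<in> Q \<Longrightarrow> \<tau> p = p \<and> u = z \<or> \<tau> p = u \<and> p = z \<or> \<tau> p = z \<and> p = u \<or>
       distinct [\<tau> p, p, u, z] \<and> Q = {\<tau> p, p, u, z}"
proof (cases "u = z")
  case True
  then show thesis using that[of id] by auto
next
  case False
  then have "card (Q - {u, z}) = 2" using assms by (subst card_Diff_subset) auto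
  then obtain v w where vw: "Q - {u, z} = {v, w}" "v \<noteq> w" by (meson card_2_iff)
  then have Q: "Q = {z, u, v, w}" and ne: "v \<noteq> u" "v \<noteq> z" "w \<noteq> u" "w \<noteq> z" using assms by blast+
  define \<tau> where "\<tau> p = (if p = z then u else if p = u then z else if p = v then w else v)" for p
  show thesis
  proof (rule that)
    show "bij_betw \<tau> Q Q"
      by (rule bij_betw_byWitness[where f' = \<tau>]) (use ne vw(2) False in \<open>auto simp: \<tau>_def Q\<close>)
    show "\<tau> p = p \<and> u = z \<or> \<tau> p = u \<and> p = z \<or> \<tau> p = z \<and> p = u \<or>
       distinct [\<tau> p, p, u, z] \<and> Q = {\<tau> p, p, u, z}" if "p \<in> Q" for p
      using that ne vw(2) False unfolding Q by (auto simp: \<tau>_def)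
  qed
qed

text \<open>Constraint \<open>k\<close> prescribes the product \<open>s k\<close> of the
  \<plusminus>1 values of the points in \<open>Q k\<close>. The size \<open>2 * L + 2\<close> is
  that of the largest combination formed below: two correlation witnesses of size at most
  \<open>L\<close> and two single constraints. \<open>gap\<close> brings such a combination back to
  size \<open>L\<close>, so that correlations can be composed again and again.\<close>

locale parity_system =
  fixes N :: "'k set" and Q :: "'k \<Rightarrow> 'p set" and s :: "'k \<Rightarrow> real" and L :: nat
  assumes finite_N: "finite N"
    and sign: "k \<in> N \<Longrightarrow> s k * s k = 1"
    and independent:
      "\<lbrakk>I \<subseteq> N; card I \<le> 2 * L + 2; {p. odd (card {k \<in> I. p \<in> Q k})} = {}\<rbrakk> \<Longrightarrow> I = {}"
    and gap:
      "\<lbrakk>I \<subseteq> N; card I \<le> 2 * L + 2; card {p. odd (card {k \<in> I. p \<in> Q k})} \<le> 2\<rbrakk> \<Longrightarrow> card I \<le> L"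
begin

text \<open>Multiplying the constraints in \<open>I\<close> gives a constraint on exactly these
  points, since a point that occurs an even number of times contributes a square. The locale
  assumptions spell this set out.\<close>

definition bdry :: "'k set \<Rightarrow> 'p set" where
  "bdry I = {p. odd (card {k \<in> I. p \<in> Q k})}"

lemma bdry_empty [simp]: "bdry {} = {}"
  by (simp add: bdry_def)

lemma bdry_singleton [simp]: "bdry {k} = Q k"
proof -
  have "{j. j = k \<and> p \<in> Q j} = (if p \<in> Q k then {k} else {})" for p by auto
  then show ?thesis by (auto simp: bdry_def)
qed

lemma bdry_sym_diff:
  assumes "I \<subseteq> N" "J \<subseteq> N"
  shows "bdry (sym_diff I J) = sym_diff (bdry I) (bdry J)"
proof -
  have "finite I" "finite J" using assms finite_N finite_subset by blast+
  then have *: "finite {k \<in> I. p \<in> Q k}" "finite {k \<in> J. p \<in> Q k}" for p by auto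
  have "{k \<in> sym_diff I J. p \<in> Q k} = sym_diff {k \<in> I. p \<in> Q k} {k \<in> J. p \<in> Q k}" for p by blast
  then show ?thesis
    unfolding bdry_def using odd_card_sym_diff[OF *] by auto
qed

text \<open>The common constraints enter the right-hand side squared, hence as 1.\<close>

lemma prod_sym_diff:
  assumes "I \<subseteq> N" "J \<subseteq> N"
  shows "prod s (sym_diff I J) = prod s I * prod s J"
proof -
  have fin: "finite I" "finite J" using assms finite_N finite_subset by blast+
  have "prod s I = prod s (I - J) * prod s (I \<inter> J)" "prod s J = prod s (J - I) * prod s (I \<inter> J)"
    using prod.Int_Diff[of I s J] prod.Int_Diff[of J s I] fin by (simp_all add: Int_commute mult.commute)
  moreover have "prod s (I \<inter> J) * prod s (I \<inter> J) = 1"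
    unfolding prod.distrib[symmetric] using sign assms by (intro prod.neutral) blast
  moreover have "prod s (sym_diff I J) = prod s (I - J) * prod s (J - I)"
    using fin by (intro prod.union_disjoint) auto
  ultimately show ?thesis by (simp add: algebra_simps)
qed

lemma prod_sq: "I \<subseteq> N \<Longrightarrow> prod s I * prod s I = 1"
  unfolding prod.distrib[symmetric] using sign by (intro prod.neutral) blast

lemma card_sym_diff_le: "card (sym_diff I J) \<le> card I + card J" if "I \<subseteq> N" "J \<subseteq> N"
proof -
  have fin: "finite I" "finite J" using that finite_N finite_subset by blast+
  have "card (sym_diff I J) \<le> card (I - J) + card (J - I)" by (rule card_Un_le)
  also have "\<dots> \<le> card I + card J"
    using fin by (intro add_mono card_mono) auto
  finally show ?thesis .
qed

text \<open>With \<open>sym_diff {p} {q}\<close> instead of \<open>{p, q}\<close> the boundary is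
  empty for \<open>p = q\<close>, so the empty combination connects a point to itself.\<close>

definition connects :: "'k set \<Rightarrow> 'p \<Rightarrow> 'p \<Rightarrow> bool" where
  "connects I p q \<longleftrightarrow> I \<subseteq> N \<and> card I \<le> L \<and> bdry I = sym_diff {p} {q}"

text \<open>
  Plays the role of the expected product of the values of \<open>p\<close> and \<open>q\<close>. The choice of \<open>I\<close> is
  immaterial, see \<open>corr_eq\<close>.
\<close>

definition corr :: "'p \<Rightarrow> 'p \<Rightarrow> real" where
  "corr p q = (if \<exists>I. connects I p q then prod s (SOME I. connects I p q) else 0)"

text \<open>By \<open>gap\<close> the set \<open>I\<close> has at most \<open>L\<close> elements and
  is itself a witness. Its symmetric difference with the chosen witness has at most
  \<open>2 * L\<close> elements and empty boundary, so \<open>independent\<close> makes the two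
  equal. Allowing \<open>I\<close> to have size up to \<open>2 * L + 2\<close> lets combinations of
  witnesses be plugged in directly.\<close>

lemma corr_eq:
  assumes I: "I \<subseteq> N" "card I \<le> 2 * L + 2" "bdry I = sym_diff {p} {q}"
  shows "corr p q = prod s I"
proof -
  have "card (sym_diff {p} {q}) \<le> 2" by (rule order_trans[OF card_mono[of "{p, q}"]]) (auto simp: card_insert_if)
  with gap[of I] I have c: "connects I p q" unfolding connects_def bdry_def by auto
  define J where "J = (SOME I. connects I p q)"
  have J: "connects J p q" unfolding J_def using c by (rule someI)
  have "sym_diff I J = {}"
  proof (rule independent)
    show "sym_diff I J \<subseteq> N" using c J unfolding connects_def by blast
    show "card (sym_diff I J) \<le> 2 * L + 2"
      using card_sym_diff_le[of I J] c J unfolding connects_def by auto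
    show "{p. odd (card {k \<in> sym_diff I J. p \<in> Q k})} = {}"
      using bdry_sym_diff[of I J] c J unfolding connects_def bdry_def by simp
  qed
  then have "I = J" by blast
  then show ?thesis using c unfolding corr_def J_def by auto
qed

lemma corr_nonzeroE:
  assumes "corr p q \<noteq> 0"
  obtains I where "I \<subseteq> N" "card I \<le> L" "bdry I = sym_diff {p} {q}" "corr p q = prod s I"
proof -
  from assms obtain I where "connects I p q" unfolding corr_def by meson
  then show thesis using that corr_eq[of I p q] unfolding connects_def by auto
qed

lemma corr_sq: "corr p q \<noteq> 0 \<Longrightarrow> corr p q * corr p q = 1"
  by (metis corr_nonzeroE prod_sq)

lemma corr_refl [simp]: "corr p p = 1"
  using corr_eq[of "{}" p p] by simp

lemma corr_sym: "corr p q = corr q p"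
proof -
  have "corr q p = corr p q" if nz: "corr p q \<noteq> 0" for p q
  proof -
    obtain I where "I \<subseteq> N" "card I \<le> L" "bdry I = sym_diff {p} {q}" "corr p q = prod s I"
      using nz by (rule corr_nonzeroE)
    then show ?thesis by (subst corr_eq[of I]) auto
  qed
  then show ?thesis by metis
qed

text \<open>The point \<open>q\<close> cancels in the boundary of the symmetric difference of the
  two witnesses.\<close>

lemma corr_trans:
  assumes "corr p q \<noteq> 0" "corr q r \<noteq> 0"
  shows "corr p r = corr p q * corr q r"
proof -
  obtain I where I: "I \<subseteq> N" "card I \<le> L" "bdry I = sym_diff {p} {q}" "corr p q = prod s I"
    using assms(1) by (rule corr_nonzeroE)
  obtain J where J: "J \<subseteq> N" "card J \<le> L" "bdry J = sym_diff {q} {r}" "corr q r = prod s J"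
    using assms(2) by (rule corr_nonzeroE)
  have "corr p r = prod s (sym_diff I J)"
  proof (rule corr_eq)
    show "bdry (sym_diff I J) = sym_diff {p} {r}"
      unfolding bdry_sym_diff[OF I(1) J(1)] I(3) J(3) by blast
    show "card (sym_diff I J) \<le> 2 * L + 2"
      using card_sym_diff_le[OF I(1) J(1)] I J by linarith
  qed (use I(1) J(1) in blast)
  then show ?thesis using prod_sym_diff I J by simp
qed

text \<open>Here \<open>p'\<close> and \<open>q'\<close> stand for the translates of
  \<open>p\<close> by \<open>u\<close> and of \<open>q\<close> by \<open>u'\<close>, with
  \<open>z\<close> as neutral element; \<open>e\<close> and \<open>e'\<close> are the constraints,
  at most one each, that justify the translations. The witness for \<open>p'\<close> and
  \<open>q'\<close> combines all four sets, which is where \<open>2 * L + 2\<close> comes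
  from.\<close>

lemma corr_translate:
  assumes nz: "corr p q \<noteq> 0" "corr u u' \<noteq> 0"
    and e: "e \<subseteq> N" "card e \<le> 1" "bdry e = sym_diff (sym_diff {p'} {p}) (sym_diff {u} {z})"
    and e': "e' \<subseteq> N" "card e' \<le> 1" "bdry e' = sym_diff (sym_diff {q'} {q}) (sym_diff {u'} {z})"
  shows "corr p' q' = corr p q * corr u u' * prod s e * prod s e'"
proof -
  obtain I where I: "I \<subseteq> N" "card I \<le> L" "bdry I = sym_diff {p} {q}" "corr p q = prod s I"
    using nz(1) by (rule corr_nonzeroE)
  obtain J where J: "J \<subseteq> N" "card J \<le> L" "bdry J = sym_diff {u} {u'}" "corr u u' = prod s J"
    using nz(2) by (rule corr_nonzeroE)
  define A where "A = sym_diff I J"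
  define B where "B = sym_diff e e'"
  have sub: "A \<subseteq> N" "B \<subseteq> N" using I(1) J(1) e(1) e'(1) unfolding A_def B_def by blast+
  have "corr p' q' = prod s (sym_diff A B)"
  proof (rule corr_eq)
    show "bdry (sym_diff A B) = sym_diff {p'} {q'}"
      unfolding bdry_sym_diff[OF sub] unfolding A_def B_def
        bdry_sym_diff[OF I(1) J(1)] bdry_sym_diff[OF e(1) e'(1)] I(3) J(3) e(3) e'(3)
      by (rule sym_diff_cancel)
    show "card (sym_diff A B) \<le> 2 * L + 2"
      using card_sym_diff_le[OF I(1) J(1)] card_sym_diff_le[OF e(1) e'(1)] card_sym_diff_le[OF sub] I J e e'
      unfolding A_def B_def by linarith
  qed (use sub in blast)
  then show ?thesis using prod_sym_diff[OF sub] prod_sym_diff[OF I(1) J(1)] prod_sym_diff[OF e(1) e'(1)] I J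
    unfolding A_def B_def by simp
qed

text \<open>
  Translating by a correlated pair \<open>(u, u')\<close> multiplies each summand by the summand at \<open>(u, u')\<close>.
\<close>

lemma signed_sum_translate:
  fixes x y :: "'p \<Rightarrow> real"
  assumes k: "k \<in> N" "card (Q k) = 4" "z \<in> Q k" "\<And>p. x p * x p = 1" "x z = 1" "prod x (Q k) = s k"
    and l: "l \<in> N" "card (Q l) = 4" "z \<in> Q l" "\<And>p. y p * y p = 1" "y z = 1" "prod y (Q l) = s l"
    and u: "u \<in> Q k" "u' \<in> Q l" "corr u u' \<noteq> 0"
  shows "(\<Sum>p\<in>Q k. \<Sum>q\<in>Q l. x p * y q * corr p q) =
    x u * y u' * corr u u' * (\<Sum>p\<in>Q k. \<Sum>q\<in>Q l. x p * y q * corr p q)"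
proof -
  \<comment> \<open>In the degenerate cases of the translation the relation
    \<open>x p' = x p * x u\<close> follows from \<open>x z = 1\<close> and
    \<open>x u * x u = 1\<close>, and \<open>e\<close> is empty. If the four points are distinct,
    they exhaust \<open>Q k\<close>, and \<open>e = {k}\<close>.\<close>
  have witness: "\<exists>e\<subseteq>N. card e \<le> 1 \<and> bdry e = sym_diff (sym_diff {p'} {p}) (sym_diff {u} {z}) \<and>
      x p' = x p * x u * prod s e"
    if "k \<in> N" "p' = p \<and> u = z \<or> p' = u \<and> p = z \<or> p' = z \<and> p = u \<or>
      distinct [p', p, u, z] \<and> Q k = {p', p, u, z}"
      "\<And>p. x p * x p = 1" "x z = 1" "prod x (Q k) = s k" for k u p p' and x :: "'p \<Rightarrow> real"
  proof (cases "distinct [p', p, u, z] \<and> Q k = {p', p, u, z}")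
    case True
    then have d: "p' \<noteq> p" "p' \<noteq> u" "p' \<noteq> z" "p \<noteq> u" "p \<noteq> z" "u \<noteq> z" and Q: "Q k = {p', p, u, z}" by auto
    have "s k = x p' * x p * x u" using that(4,5) d unfolding Q by (simp add: algebra_simps)
    then have "x p * x u * s k = x p' * (x p * x p) * (x u * x u)" by (simp add: algebra_simps)
    then show ?thesis using that(1,3) d by (intro exI[of _ "{k}"]) (auto simp: Q)
  next
    case False
    then show ?thesis using that by (intro exI[of _ "{}"]) auto
  qed
  obtain \<tau> where \<tau>: "bij_betw \<tau> (Q k) (Q k)"
    "\<And>p. p \<in> Q k \<Longrightarrow> \<tau> p = p \<and> u = z \<or> \<tau> p = u \<and> p = z \<or> \<tau> p = z \<and> p = u \<or>
       distinct [\<tau> p, p, u, z] \<and> Q k = {\<tau> p, p, u, z}"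
    using klein_translation[OF k(2,3) u(1)] by metis
  obtain \<tau>' where \<tau>': "bij_betw \<tau>' (Q l) (Q l)"
    "\<And>p. p \<in> Q l \<Longrightarrow> \<tau>' p = p \<and> u' = z \<or> \<tau>' p = u' \<and> p = z \<or> \<tau>' p = z \<and> p = u' \<or>
       distinct [\<tau>' p, p, u', z] \<and> Q l = {\<tau>' p, p, u', z}"
    using klein_translation[OF l(2,3) u(2)] by metis
  have step: "x (\<tau> p) * y (\<tau>' q) * corr (\<tau> p) (\<tau>' q) = x u * y u' * corr u u' * (x p * y q * corr p q)"
    if p: "p \<in> Q k" and q: "q \<in> Q l" for p q
  proof -
    obtain e where e: "e \<subseteq> N" "card e \<le> 1" "bdry e = sym_diff (sym_diff {\<tau> p} {p}) (sym_diff {u} {z})"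
      "x (\<tau> p) = x p * x u * prod s e"
      using witness[OF k(1) \<tau>(2)[OF p] k(4,5,6)] by blast
    obtain e' where e': "e' \<subseteq> N" "card e' \<le> 1"
      "bdry e' = sym_diff (sym_diff {\<tau>' q} {q}) (sym_diff {u'} {z})"
      "y (\<tau>' q) = y q * y u' * prod s e'"
      using witness[OF l(1) \<tau>'(2)[OF q] l(4,5,6)] by blast
    show ?thesis
    proof (cases "corr p q = 0")
      case True
      have "corr (\<tau> p) (\<tau>' q) = 0"
      proof (rule ccontr)
        assume nz: "corr (\<tau> p) (\<tau>' q) \<noteq> 0"
        \<comment> \<open>The boundary of \<open>e\<close> is symmetric in \<open>p\<close> and
          \<open>\<tau> p\<close>, and likewise for \<open>e'\<close>, so the same sets also
          translate back.\<close>
        have "corr p q = corr (\<tau> p) (\<tau>' q) * corr u u' * prod s e * prod s e'"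
          by (rule corr_translate[OF nz u(3) e(1,2) _ e'(1,2)])
            (simp_all only: e(3) e'(3) Un_commute[of "{\<tau> p} - {p}"] Un_commute[of "{\<tau>' q} - {q}"])
        then show False using True nz u(3) prod_sq[OF e(1)] prod_sq[OF e'(1)] by auto
      qed
      then show ?thesis using True by simp
    next
      case False
      have "corr (\<tau> p) (\<tau>' q) = corr p q * corr u u' * prod s e * prod s e'"
        by (rule corr_translate[OF False u(3) e(1,2,3) e'(1,2,3)])
      then have "x (\<tau> p) * y (\<tau>' q) * corr (\<tau> p) (\<tau>' q) = x u * y u' * corr u u' * (x p * y q * corr p q)
          * (prod s e * prod s e) * (prod s e' * prod s e')"
        unfolding e(4) e'(4) by (simp only: ac_simps)
      then show ?thesis using prod_sq[OF e(1)] prod_sq[OF e'(1)] by simp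
    qed
  qed
  have "(\<Sum>p\<in>Q k. \<Sum>q\<in>Q l. x p * y q * corr p q) =
      (\<Sum>p\<in>Q k. \<Sum>q\<in>Q l. x (\<tau> p) * y (\<tau>' q) * corr (\<tau> p) (\<tau>' q))"
    using sum.reindex_bij_betw[OF \<tau>(1), of "\<lambda>p. \<Sum>q\<in>Q l. x p * y q * corr p q"]
      sum.reindex_bij_betw[OF \<tau>'(1), of "\<lambda>q. x (\<tau> p) * y q * corr (\<tau> p) q" for p] by simp
  also have "\<dots> = (\<Sum>p\<in>Q k. \<Sum>q\<in>Q l. x u * y u' * corr u u' * (x p * y q * corr p q))"
    using step by (intro sum.cong refl) simp
  finally show ?thesis unfolding sum_distrib_left .
qed

text \<open>Each summand is 0, 1 or -1. If some summand is -1, translating by its pair negates the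
  sum, which is therefore 0; otherwise the sum is nonnegative term by term. A common point
  \<open>p\<close> at which \<open>x\<close> and \<open>y\<close> differ supplies the summand -1 at
  the pair of \<open>p\<close> with itself.\<close>

lemma signed_sum:
  fixes x y :: "'p \<Rightarrow> real"
  assumes k: "k \<in> N" "card (Q k) = 4" "z \<in> Q k" "\<And>p. x p * x p = 1" "x z = 1" "prod x (Q k) = s k"
    and l: "l \<in> N" "card (Q l) = 4" "z \<in> Q l" "\<And>p. y p * y p = 1" "y z = 1" "prod y (Q l) = s l"
  shows signed_sum_nonneg: "(\<Sum>p\<in>Q k. \<Sum>q\<in>Q l. x p * y q * corr p q) \<ge> 0"
    and signed_sum_zero: "\<lbrakk>p \<in> Q k; p \<in> Q l; x p \<noteq> y p\<rbrakk> \<Longrightarrow>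
      (\<Sum>p\<in>Q k. \<Sum>q\<in>Q l. x p * y q * corr p q) = 0"
proof -
  have neg: "(\<Sum>p\<in>Q k. \<Sum>q\<in>Q l. x p * y q * corr p q) = 0"
    if u: "u \<in> Q k" "u' \<in> Q l" "x u * y u' * corr u u' < 0" for u u'
  proof -
    have nz: "corr u u' \<noteq> 0" using u by auto
    have "(x u * y u' * corr u u')\<^sup>2 = (x u * x u) * (y u' * y u') * (corr u u' * corr u u')"
      by (simp add: power2_eq_square)
    also have "\<dots> = 1" using k(4) l(4) corr_sq[OF nz] by simp
    finally have "x u * y u' * corr u u' = -1" using u(3) by (auto simp: power2_eq_1_iff)
    then show ?thesis using signed_sum_translate[OF k l u(1,2) nz] by simp
  qed
  show "(\<Sum>p\<in>Q k. \<Sum>q\<in>Q l. x p * y q * corr p q) \<ge> 0"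
    using neg by (metis (no_types, lifting) linorder_not_le order_refl sum_nonneg)
  show "(\<Sum>p\<in>Q k. \<Sum>q\<in>Q l. x p * y q * corr p q) = 0" if p: "p \<in> Q k" "p \<in> Q l" "x p \<noteq> y p"
  proof (rule neg[OF p(1,2)])
    have "x p = 1 \<or> x p = -1" "y p = 1 \<or> y p = -1" using k(4) l(4) by (simp_all add: square_eq_1_iff)
    then show "x p * y p * corr p p < 0" using p(3) by auto
  qed
qed

end

section \<open>Assignments in a cloud\<close>

text \<open>The prepended point 0 always has value 1. The value -1 at variables outside the domain
  keeps every square equal to 1, as \<open>signed_sum\<close> demands at all points.\<close>

definition sgn_of :: "partial_assignment \<Rightarrow> nat \<Rightarrow> real" where
  "sgn_of a p = (if p = 0 \<or> a p = Some True then 1 else -1)"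

text \<open>The sign of a variable is that of its literal, negated if the literal is false. With an
  odd number of true literals among three, an even number is false, so the product of the variables'
  signs is the product of the literals' signs.\<close>

definition rhs :: "clause \<Rightarrow> real" where
  "rhs C = (\<Prod>l\<in>C. if snd l then 1 else -1)"

lemma clauseE:
  assumes "C \<in> clauses n"
  obtains i j k x y z where "C = {(i, x), (j, y), (k, z)}" "i \<noteq> j" "i \<noteq> k" "j \<noteq> k"
    "i \<in> {1..n}" "j \<in> {1..n}" "k \<in> {1..n}"
proof -
  have C: "C \<subseteq> {1..n} \<times> UNIV" "card C = 3" "inj_on fst C" using assms by (auto simp: clauses_def)
  obtain a b c where abc: "C = {a, b, c}" "a \<noteq> b" "a \<noteq> c" "b \<noteq> c"
    using C(2) unfolding card_3_iff by metis
  then have "fst a \<noteq> fst b" "fst a \<noteq> fst c" "fst b \<noteq> fst c" using C(3) by (auto simp: inj_on_def)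
  moreover have "fst a \<in> {1..n}" "fst b \<in> {1..n}" "fst c \<in> {1..n}"
    using C(1) abc(1) by (auto simp: mem_Times_iff)
  moreover have "C = {(fst a, snd a), (fst b, snd b), (fst c, snd c)}" using abc(1) by simp
  ultimately show thesis by (intro that)
qed

text \<open>The first assignment makes all three literals true, each of the others exactly
  one.\<close>

lemma xor_assignments_eq:
  assumes "i \<noteq> j" "i \<noteq> k" "j \<noteq> k"
  shows "xor_assignments {(i, x), (j, y), (k, z)} =
    {[i \<mapsto> x, j \<mapsto> y, k \<mapsto> z], [i \<mapsto> x, j \<mapsto> \<not> y, k \<mapsto> \<not> z],
     [i \<mapsto> \<not> x, j \<mapsto> y, k \<mapsto> \<not> z], [i \<mapsto> \<not> x, j \<mapsto> \<not> y, k \<mapsto> z]}"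
    (is "xor_assignments ?C = ?R")
proof -
  have card: "odd (card (true_literals [i \<mapsto> p, j \<mapsto> q, k \<mapsto> r] ?C)) \<longleftrightarrow> ((p = x) \<noteq> (q = y)) \<noteq> (r = z)"
    for p q r
  proof -
    have filter: "{l \<in> insert c A. P l} = (if P c then insert c {l \<in> A. P l} else {l \<in> A. P l})"
      for c :: literal and A P by auto
    have "true_literals [i \<mapsto> p, j \<mapsto> q, k \<mapsto> r] ?C =
        (if p = x then {(i, x)} else {}) \<union> (if q = y then {(j, y)} else {}) \<union> (if r = z then {(k, z)} else {})"
      using assms unfolding true_literals_def filter by simp
    then show ?thesis using assms by (cases "p = x"; cases "q = y"; cases "r = z") simp_all
  qed
  have dom: "dom a = {i, j, k} \<longleftrightarrow> (\<exists>p q r. a = [i \<mapsto> p, j \<mapsto> q, k \<mapsto> r])" for a :: partial_assignment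
  proof
    assume d: "dom a = {i, j, k}"
    then obtain p q r where "a i = Some p" "a j = Some q" "a k = Some r" by blast
    moreover have "a l = None" if "l \<notin> {i, j, k}" for l using d that by blast
    ultimately have "a = [i \<mapsto> p, j \<mapsto> q, k \<mapsto> r]" using assms by (auto simp: fun_eq_iff)
    then show "\<exists>p q r. a = [i \<mapsto> p, j \<mapsto> q, k \<mapsto> r]" by blast
  qed (auto split: if_splits)
  have parity: "(\<exists>p q r. a = f p q r \<and> ((p = x) \<noteq> (q = y)) \<noteq> (r = z)) \<longleftrightarrow>
      a \<in> {f x y z, f x (\<not> y) (\<not> z), f (\<not> x) y (\<not> z), f (\<not> x) (\<not> y) z}"
    for a :: partial_assignment and f
    by (cases x; cases y; cases z; simp add: ex_bool_eq; blast)
  have "a \<in> xor_assignments ?C \<longleftrightarrow>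
      (\<exists>p q r. a = [i \<mapsto> p, j \<mapsto> q, k \<mapsto> r] \<and> ((p = x) \<noteq> (q = y)) \<noteq> (r = z))" for a
  proof -
    have "a \<in> xor_assignments ?C \<longleftrightarrow> dom a = {i, j, k} \<and> odd (card (true_literals a ?C))"
      unfolding xor_assignments_def by simp
    also have "\<dots> \<longleftrightarrow> (\<exists>p q r. a = [i \<mapsto> p, j \<mapsto> q, k \<mapsto> r]) \<and> odd (card (true_literals a ?C))"
      unfolding dom ..
    also have "\<dots> \<longleftrightarrow> (\<exists>p q r. a = [i \<mapsto> p, j \<mapsto> q, k \<mapsto> r] \<and> ((p = x) \<noteq> (q = y)) \<noteq> (r = z))"
    proof (intro iffI; elim exE conjE)
      fix p q r
      assume a: "a = [i \<mapsto> p, j \<mapsto> q, k \<mapsto> r]" and "odd (card (true_literals a ?C))"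
      then have "((p = x) \<noteq> (q = y)) \<noteq> (r = z)" by (simp only: card not_False_eq_True)
      with a show "\<exists>p q r. a = [i \<mapsto> p, j \<mapsto> q, k \<mapsto> r] \<and> ((p = x) \<noteq> (q = y)) \<noteq> (r = z)" by blast
    next
      fix p q r
      assume a: "a = [i \<mapsto> p, j \<mapsto> q, k \<mapsto> r]" and "((p = x) \<noteq> (q = y)) \<noteq> (r = z)"
      then have "odd (card (true_literals a ?C))" by (simp only: card not_False_eq_True)
      with a show "(\<exists>p q r. a = [i \<mapsto> p, j \<mapsto> q, k \<mapsto> r]) \<and> odd (card (true_literals a ?C))" by blast
    qed
    finally show ?thesis .
  qed
  then show ?thesis unfolding parity by (rule Set.set_eqI)
qed

lemma xor_assignmentsE:
  assumes "C \<in> clauses n"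
  obtains i j k x y z a b c d where
    "C = {(i, x), (j, y), (k, z)}" "i \<noteq> j" "i \<noteq> k" "j \<noteq> k" "i \<noteq> 0" "j \<noteq> 0" "k \<noteq> 0"
    "xor_assignments C = {a, b, c, d}"
    "a i = Some x" "a j = Some y" "a k = Some z"
    "b i = Some x" "b j = Some (\<not> y)" "b k = Some (\<not> z)"
    "c i = Some (\<not> x)" "c j = Some y" "c k = Some (\<not> z)"
    "d i = Some (\<not> x)" "d j = Some (\<not> y)" "d k = Some z"
proof -
  obtain i j k x y z where C: "C = {(i, x), (j, y), (k, z)}" and ne: "i \<noteq> j" "i \<noteq> k" "j \<noteq> k"
    and pos: "i \<in> {1..n}" "j \<in> {1..n}" "k \<in> {1..n}"
    using assms by (rule clauseE)
  show thesis
    by (rule that[OF C ne _ _ _ xor_assignments_eq[OF ne, of x y z, folded C]]) (use ne pos in auto)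
qed

text \<open>All four facts are read off from the explicit cloud: each variable takes either value in
  two of the four assignments, so its signs cancel, and two different assignments disagree on two
  variables.\<close>

lemma
  assumes C: "C \<in> clauses n"
  shows finite_xor_assignments: "finite (xor_assignments C)"
    and sum_sgn_of: "p \<in> insert 0 (fst ` C) \<Longrightarrow>
      (\<Sum>a\<in>xor_assignments C. sgn_of a p) = (if p = 0 then 4 else 0)"
    and prod_sgn_of: "a' \<in> xor_assignments C \<Longrightarrow> (\<Prod>p\<in>insert 0 (fst ` C). sgn_of a' p) = rhs C"
    and xor_assignments_contradicting:
      "\<lbrakk>a' \<in> xor_assignments C; b' \<in> xor_assignments C; a' \<noteq> b'\<rbrakk> \<Longrightarrow> contradicting a' b'"
proof -
  obtain i j k x y z a b c d where
    C: "C = {(i, x), (j, y), (k, z)}" and ne: "i \<noteq> j" "i \<noteq> k" "j \<noteq> k"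
    and pos: "i \<noteq> 0" "j \<noteq> 0" "k \<noteq> 0" and xor: "xor_assignments C = {a, b, c, d}"
    and vals: "a i = Some x" "a j = Some y" "a k = Some z"
      "b i = Some x" "b j = Some (\<not> y)" "b k = Some (\<not> z)"
      "c i = Some (\<not> x)" "c j = Some y" "c k = Some (\<not> z)"
      "d i = Some (\<not> x)" "d j = Some (\<not> y)" "d k = Some z"
    using C by (rule xor_assignmentsE)
  have distinct: "a \<noteq> b" "a \<noteq> c" "a \<noteq> d" "b \<noteq> c" "b \<noteq> d" "c \<noteq> d"
    using vals by auto
  show "finite (xor_assignments C)" unfolding xor by simp
  show "contradicting a' b'" if "a' \<in> xor_assignments C" "b' \<in> xor_assignments C" "a' \<noteq> b'"
  proof -
    have contr: "contradicting a b" if "a l = Some v" "b l = Some (\<not> v)" for a b :: partial_assignment and l v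
      using that unfolding contradicting_def by (cases v) auto
    have sym: "contradicting a b \<Longrightarrow> contradicting b a" for a b
      unfolding contradicting_def by blast
    have "contradicting a b" "contradicting a c" "contradicting a d"
      "contradicting b c" "contradicting b d" "contradicting c d"
      using contr[of a j y b] contr[of a i x c] contr[of a i x d]
        contr[of b i x c] contr[of b i x d] contr[of c j y d] vals by blast+
    then show ?thesis using that sym unfolding xor by blast
  qed
  show "(\<Sum>a\<in>xor_assignments C. sgn_of a p) = (if p = 0 then 4 else 0)" if "p \<in> insert 0 (fst ` C)"
  proof -
    have "(\<Sum>a\<in>xor_assignments C. sgn_of a p) = sgn_of a p + sgn_of b p + sgn_of c p + sgn_of d p"
      unfolding xor using distinct by simp
    moreover have "p = 0 \<or> p = i \<or> p = j \<or> p = k" using that C by auto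
    ultimately show ?thesis using pos vals by (elim disjE) (simp_all add: sgn_of_def)
  qed
  show "(\<Prod>p\<in>insert 0 (fst ` C). sgn_of a' p) = rhs C" if "a' \<in> xor_assignments C"
  proof -
    have "(\<Prod>p\<in>insert 0 (fst ` C). sgn_of a' p) = sgn_of a' i * sgn_of a' j * sgn_of a' k"
      using ne pos unfolding C by (simp add: sgn_of_def)
    moreover have "rhs C = (if x then 1 else -1) * (if y then 1 else -1) * (if z then 1 else -1)"
      using ne unfolding C rhs_def by simp
    moreover have "a' = a \<or> a' = b \<or> a' = c \<or> a' = d" using that xor by blast
    ultimately show ?thesis using pos vals by (elim disjE) (simp_all add: sgn_of_def)
  qed
qed

section \<open>The theta function of the graph\<close>

unbundle no inner_syntax

lemma sum_xor_graph:
  assumes "\<And>k. k < m \<Longrightarrow> \<phi> k \<in> clauses n"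
  shows "(\<Sum>i\<in>fst (xor_graph m \<phi>). f i) = (\<Sum>k<m. \<Sum>a\<in>xor_assignments (\<phi> k). f (k, a))"
  unfolding xor_graph_def Let_def using finite_xor_assignments[OF assms]
  by (simp add: sum.Sigma split_def)

text \<open>Let \<open>c\<close> be the sum of the \<open>v i\<close>, formed coordinatewise.
  Orthogonality and \<open>v i \<bullet> v i = v i \<bullet> v0\<close> show that the squared norm
  of \<open>c\<close> equals its inner product with \<open>v0\<close>. Expanding the squared norm of
  \<open>v0 - c\<close>, which is nonnegative, gives the bound.\<close>

lemma orthogonal_sum_le:
  fixes v0 :: "real vec" and v :: "'a \<Rightarrow> real vec"
  assumes "finite A" "v0 \<in> carrier_vec d" "\<And>i. i \<in> A \<Longrightarrow> v i \<in> carrier_vec d"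
    and "v0 \<bullet> v0 = 1" "\<And>i. i \<in> A \<Longrightarrow> v i \<bullet> v i = v i \<bullet> v0"
    and "\<And>i j. \<lbrakk>i \<in> A; j \<in> A; i \<noteq> j\<rbrakk> \<Longrightarrow> v i \<bullet> v j = 0"
  shows "(\<Sum>i\<in>A. v0 \<bullet> v i) \<le> 1"
proof -
  define c where "c r = (\<Sum>i\<in>A. v i $ r)" for r
  have sp: "u \<bullet> w = (\<Sum>r<d. u $ r * w $ r)" if "w \<in> carrier_vec d" for u w :: "real vec"
    using that by (auto simp: scalar_prod_def atLeast0LessThan)
  have "(\<Sum>r<d. c r * c r) = (\<Sum>i\<in>A. \<Sum>j\<in>A. v i \<bullet> v j)"
    unfolding c_def sum_product using assms(3)
    by (simp add: sp sum.swap[where A = "{..<d}"] cong: sum.cong)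
  also have "\<dots> = (\<Sum>i\<in>A. v i \<bullet> v i)"
  proof (rule sum.cong[OF refl])
    fix i assume i: "i \<in> A"
    have "(\<Sum>j\<in>A. v i \<bullet> v j) = (\<Sum>j\<in>A. if j = i then v i \<bullet> v i else 0)"
      using assms(6) i by (intro sum.cong) auto
    then show "(\<Sum>j\<in>A. v i \<bullet> v j) = v i \<bullet> v i" using assms(1) i by simp
  qed
  also have "\<dots> = (\<Sum>i\<in>A. v i \<bullet> v0)" using assms(5) by simp
  also have "\<dots> = (\<Sum>i\<in>A. v0 \<bullet> v i)"
    using assms(2,3) by (intro sum.cong refl comm_scalar_prod[of _ d]) auto
  finally have cc: "(\<Sum>r<d. c r * c r) = (\<Sum>i\<in>A. v0 \<bullet> v i)" .
  have c0: "(\<Sum>r<d. v0 $ r * c r) = (\<Sum>i\<in>A. v0 \<bullet> v i)"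
    unfolding c_def sum_distrib_left using assms(3)
    by (simp add: sp sum.swap[where A = "{..<d}"] cong: sum.cong)
  have "0 \<le> (\<Sum>r<d. (v0 $ r - c r)\<^sup>2)" by (intro sum_nonneg) auto
  also have "\<dots> = (\<Sum>r<d. v0 $ r * v0 $ r) - 2 * (\<Sum>r<d. v0 $ r * c r) + (\<Sum>r<d. c r * c r)"
    by (simp add: power2_eq_square algebra_simps sum.distrib sum_subtractf sum_distrib_left)
  also have "\<dots> = 1 - (\<Sum>i\<in>A. v0 \<bullet> v i)"
    unfolding cc c0 using assms(4) sp[OF assms(2)] by simp
  finally show ?thesis by simp
qed

lemma theta_feasible_xor_graph_le:
  assumes "\<And>k. k < m \<Longrightarrow> \<phi> k \<in> clauses n"
    and feas: "theta_feasible (xor_graph m \<phi>) d v0 v"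
  shows "(\<Sum>i\<in>fst (xor_graph m \<phi>). v0 \<bullet> v i) \<le> real m"
proof -
  have "(\<Sum>a\<in>xor_assignments (\<phi> k). v0 \<bullet> v (k, a)) \<le> 1" if "k < m" for k
  proof (rule orthogonal_sum_le)
    have V: "(k, a) \<in> fst (xor_graph m \<phi>)" if "a \<in> xor_assignments (\<phi> k)" for a
      using that \<open>k < m\<close> by (auto simp: xor_graph_def Let_def)
    have E: "((k, a), (k, b)) \<in> snd (xor_graph m \<phi>)"
      if "a \<in> xor_assignments (\<phi> k)" "b \<in> xor_assignments (\<phi> k)" "a \<noteq> b" for a b
      using that \<open>k < m\<close> xor_assignments_contradicting[OF assms(1)] by (auto simp: xor_graph_def Let_def)
    show "finite (xor_assignments (\<phi> k))" using finite_xor_assignments[OF assms(1)] that by blast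
    show "v0 \<in> carrier_vec d" "v0 \<bullet> v0 = 1" using feas by (auto simp: theta_feasible_def)
    show "v (k, a) \<in> carrier_vec d" "v (k, a) \<bullet> v (k, a) = v (k, a) \<bullet> v0"
      if "a \<in> xor_assignments (\<phi> k)" for a
      using V[OF that] feas by (auto simp: theta_feasible_def)
    show "v (k, a) \<bullet> v (k, b) = 0"
      if "a \<in> xor_assignments (\<phi> k)" "b \<in> xor_assignments (\<phi> k)" "a \<noteq> b" for a b
      using E[OF that] feas by (auto simp: theta_feasible_def)
  qed
  then have "(\<Sum>k<m. \<Sum>a\<in>xor_assignments (\<phi> k). v0 \<bullet> v (k, a)) \<le> (\<Sum>k<m. 1)"
    by (intro sum_mono) auto
  then show ?thesis using sum_xor_graph[where \<phi> = \<phi> and m = m and f = "\<lambda>i. v0 \<bullet> v i", OF assms(1)] by simp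
qed

lemma contradicting_sgn_of:
  assumes "contradicting a b" "a \<in> xor_assignments C" "b \<in> xor_assignments D"
  obtains p where "p \<in> fst ` C" "p \<in> fst ` D" "p \<noteq> 0 \<Longrightarrow> sgn_of a p \<noteq> sgn_of b p"
proof -
  obtain p where p: "a p = Some True \<and> b p = Some False \<or> a p = Some False \<and> b p = Some True"
    using assms(1) unfolding contradicting_def by blast
  then have "p \<in> dom a" "p \<in> dom b" by auto
  then show thesis using that[of p] p assms(2,3) by (auto simp: xor_assignments_def sgn_of_def)
qed

section \<open>Coordinates of the point and clause vectors\<close>

locale nat_parity_system = parity_system N Q s L
  for N :: "'k set" and Q :: "'k \<Rightarrow> nat set" and s L +
  fixes n :: nat
  assumes Q: "k \<in> N \<Longrightarrow> Q k \<subseteq> {..n}"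
    and card_Q: "k \<in> N \<Longrightarrow> card (Q k) = 4"
    and zero_Q: "k \<in> N \<Longrightarrow> 0 \<in> Q k"
begin

text \<open>The least point of a correlation class names the coordinate axis of that class. As it is
  at most \<open>p\<close>, dimension \<open>Suc n\<close> suffices for the points up to
  \<open>n\<close>.\<close>

definition rep :: "nat \<Rightarrow> nat" where
  "rep p = (LEAST r. corr p r \<noteq> 0)"

lemma corr_rep: "corr p (rep p) \<noteq> 0"
  unfolding rep_def by (rule LeastI[of _ p]) simp

lemma rep_le: "rep p \<le> p"
  unfolding rep_def by (rule Least_le) simp

lemma rep_eq_iff: "rep p = rep q \<longleftrightarrow> corr p q \<noteq> 0"
proof
  assume "rep p = rep q"
  then show "corr p q \<noteq> 0"
    using corr_trans[of p "rep p" q] corr_rep corr_sym by (metis mult_eq_0_iff)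
next
  assume "corr p q \<noteq> 0"
  then have "corr p r \<noteq> 0 \<longleftrightarrow> corr q r \<noteq> 0" for r
    using corr_trans[of q p r] corr_trans[of p q r] corr_sym[of p q] by (metis mult_eq_0_iff)
  then show "rep p = rep q" unfolding rep_def by simp
qed

text \<open>The coordinates of \<open>V\<^sub>p\<close>.\<close>

definition coord :: "nat \<Rightarrow> nat \<Rightarrow> real" where
  "coord p r = (if r = rep p then corr p r else 0)"

text \<open>Only the axis \<open>rep p\<close> can contribute. For points of one class the product
  of their correlations with the representative is \<open>corr p q\<close> by transitivity; for
  different classes both sides vanish. So \<open>corr\<close> is a Gram matrix.\<close>

lemma sum_coord:
  assumes "p \<le> n"
  shows "(\<Sum>r<Suc n. coord p r * coord q r) = corr p q"
proof -
  have "(\<Sum>r<Suc n. coord p r * coord q r) =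
      (\<Sum>r<Suc n. if r = rep p then corr p (rep p) * coord q (rep p) else 0)"
    unfolding coord_def by (intro sum.cong) auto
  also have "\<dots> = corr p (rep p) * coord q (rep p)"
    using rep_le[of p] assms by (subst sum.delta) auto
  also have "\<dots> = corr p q"
  proof (cases "corr p q = 0")
    case True
    then show ?thesis using rep_eq_iff[of p q] by (simp add: coord_def)
  next
    case False
    then have e: "rep q = rep p" using rep_eq_iff[of p q] by simp
    then have "corr p q = corr p (rep p) * corr (rep p) q"
      using corr_rep[of p] corr_rep[of q] corr_sym by (intro corr_trans) metis+
    then show ?thesis using e corr_sym[of q] by (simp add: coord_def)
  qed
  finally show ?thesis .
qed

definition clause_vec :: "(nat \<Rightarrow> real) \<Rightarrow> 'k \<Rightarrow> real vec" where
  "clause_vec x k = vec (Suc n) (\<lambda>r. (\<Sum>p\<in>Q k. x p * coord p r) / 4)"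

lemma scalar_prod_clause_vec:
  assumes "k \<in> N"
  shows "clause_vec x k \<bullet> clause_vec y l = (\<Sum>p\<in>Q k. \<Sum>q\<in>Q l. x p * y q * corr p q) / 16"
proof -
  have "clause_vec x k \<bullet> clause_vec y l =
      (\<Sum>r<Suc n. (\<Sum>p\<in>Q k. \<Sum>q\<in>Q l. x p * y q * (coord p r * coord q r)) / 16)"
    unfolding scalar_prod_def clause_vec_def
    by (simp add: atLeast0LessThan sum_product ac_simps del: sum.lessThan_Suc)
  also have "\<dots> = (\<Sum>p\<in>Q k. \<Sum>q\<in>Q l. x p * y q * (\<Sum>r<Suc n. coord p r * coord q r)) / 16"
    unfolding sum_divide_distrib[symmetric] sum_distrib_left
    by (subst sum.swap, subst (2) sum.swap) (rule refl)
  also have "\<dots> = (\<Sum>p\<in>Q k. \<Sum>q\<in>Q l. x p * y q * corr p q) / 16"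
    using Q[OF assms] sum_coord by (intro arg_cong[of _ _ "\<lambda>t. t / 16"] sum.cong refl) auto
  finally show ?thesis .
qed

lemma scalar_prod_clause_vec_zero:
  assumes "k \<in> N"
  shows "clause_vec x k \<bullet> vec (Suc n) (coord 0) = (\<Sum>p\<in>Q k. x p * corr p 0) / 4"
proof -
  have "clause_vec x k \<bullet> vec (Suc n) (coord 0) =
      (\<Sum>r<Suc n. (\<Sum>p\<in>Q k. x p * (coord p r * coord 0 r)) / 4)"
    unfolding scalar_prod_def clause_vec_def
    by (simp add: atLeast0LessThan sum_distrib_left sum_distrib_right ac_simps del: sum.lessThan_Suc)
  also have "\<dots> = (\<Sum>p\<in>Q k. x p * (\<Sum>r<Suc n. coord p r * coord 0 r)) / 4"
    unfolding sum_divide_distrib[symmetric] sum_distrib_left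
    by (subst sum.swap) (rule refl)
  also have "\<dots> = (\<Sum>p\<in>Q k. x p * corr p 0) / 4"
    using Q[OF assms] sum_coord by (intro arg_cong[of _ _ "\<lambda>t. t / 4"] sum.cong refl) auto
  finally show ?thesis .
qed

end

lemma lovasz_theta_xor_graph:
  fixes n :: nat
  assumes \<phi>: "\<And>k. k < m \<Longrightarrow> \<phi> k \<in> clauses n"
    and sys: "parity_system {..<m} (\<lambda>k. insert 0 (fst ` \<phi> k)) (\<lambda>k. rhs (\<phi> k)) L"
  shows "lovasz_theta (xor_graph m \<phi>) = real m"
proof -
  define Q where "Q = (\<lambda>k. insert 0 (fst ` \<phi> k))"
  define s where "s = (\<lambda>k. rhs (\<phi> k))"
  have Qk: "Q k \<subseteq> {..n}" "card (Q k) = 4" "0 \<in> Q k" "0 \<notin> fst ` \<phi> k" if k: "k < m" for k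
  proof -
    obtain i j l x y z where "\<phi> k = {(i, x), (j, y), (l, z)}" "i \<noteq> j" "i \<noteq> l" "j \<noteq> l"
      "i \<in> {1..n}" "j \<in> {1..n}" "l \<in> {1..n}"
      using \<phi>[OF k] by (rule clauseE)
    then show "Q k \<subseteq> {..n}" "card (Q k) = 4" "0 \<in> Q k" "0 \<notin> fst ` \<phi> k" by (auto simp: Q_def)
  qed
  interpret parity_system "{..<m}" Q s L using sys unfolding Q_def s_def .
  interpret nat_parity_system "{..<m}" Q s L n
    by unfold_locales (use Qk in auto)
  define v0 where "v0 = vec (Suc n) (coord 0)"
  define v where "v = (\<lambda>(k, a). clause_vec (sgn_of a) k)"
  have sgn: "sgn_of a p * sgn_of a p = 1" "sgn_of a 0 = 1" for a p by (auto simp: sgn_of_def)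
  have prod: "prod (sgn_of a) (Q k) = s k" if "k < m" "a \<in> xor_assignments (\<phi> k)" for a k
    unfolding Q_def s_def by (rule prod_sgn_of[OF \<phi>[OF that(1)] that(2)])
  \<comment> \<open>Summing over a cloud leaves only the point 0. The coefficients \<open>c\<close>
    are later correlations with a fixed point, which yields both \<open>self\<close> and the
    objective value.\<close>
  have total: "(\<Sum>a\<in>xor_assignments (\<phi> k). \<Sum>p\<in>Q k. sgn_of a p * c p) = 4 * c 0" if "k < m" for k c
  proof -
    have "(\<Sum>a\<in>xor_assignments (\<phi> k). \<Sum>p\<in>Q k. sgn_of a p * c p) =
        (\<Sum>p\<in>Q k. (\<Sum>a\<in>xor_assignments (\<phi> k). sgn_of a p) * c p)"
      by (subst sum.swap) (simp add: sum_distrib_right)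
    also have "\<dots> = (\<Sum>p\<in>Q k. if p = 0 then 4 * c 0 else 0)"
      by (intro sum.cong) (auto simp: Q_def sum_sgn_of[OF \<phi>[OF that]])
    also have "\<dots> = 4 * c 0" using Qk[OF that] finite_subset[OF Qk(1)[OF that]] by simp
    finally show ?thesis .
  qed
  have nonneg: "v (k, a) \<bullet> v (l, b) \<ge> 0"
    if "k < m" "l < m" "a \<in> xor_assignments (\<phi> k)" "b \<in> xor_assignments (\<phi> l)" for k l a b
    using signed_sum_nonneg[of k 0 "sgn_of a" l "sgn_of b"] Qk that sgn prod
    by (simp add: v_def scalar_prod_clause_vec)
  have orth: "v (k, a) \<bullet> v (l, b) = 0"
    if ab: "k < m" "l < m" "a \<in> xor_assignments (\<phi> k)" "b \<in> xor_assignments (\<phi> l)" "contradicting a b"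
    for k l a b
  proof -
    obtain p where p: "p \<in> fst ` \<phi> k" "p \<in> fst ` \<phi> l" "p \<noteq> 0 \<Longrightarrow> sgn_of a p \<noteq> sgn_of b p"
      using contradicting_sgn_of[OF ab(5,3,4)] by blast
    have "p \<noteq> 0" using p(1) Qk(4)[OF ab(1)] by metis
    with p have "p \<in> Q k" "p \<in> Q l" "sgn_of a p \<noteq> sgn_of b p" unfolding Q_def by blast+
    then show ?thesis
      using signed_sum_zero[of k 0 "sgn_of a" l "sgn_of b" p] Qk ab sgn prod
      by (simp add: v_def scalar_prod_clause_vec)
  qed
  \<comment> \<open>The vectors of a cloud are orthogonal and sum to \<open>v0\<close>.\<close>
  have self: "v (k, a) \<bullet> v (k, a) = v (k, a) \<bullet> v0"
    if k: "k < m" and a: "a \<in> xor_assignments (\<phi> k)" for k a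
  proof -
    have fin: "finite (xor_assignments (\<phi> k))" using finite_xor_assignments[OF \<phi>[OF k]] .
    have "v (k, a) \<bullet> v0 = (\<Sum>p\<in>Q k. sgn_of a p * (4 * corr p 0)) / 16"
      using k by (simp add: v_def v0_def scalar_prod_clause_vec_zero sum_distrib_left mult.left_commute)
    also have "\<dots> = (\<Sum>p\<in>Q k. sgn_of a p * (\<Sum>b\<in>xor_assignments (\<phi> k). \<Sum>q\<in>Q k. sgn_of b q * corr p q)) / 16"
      using total[OF k] by simp
    also have "\<dots> = (\<Sum>b\<in>xor_assignments (\<phi> k). v (k, a) \<bullet> v (k, b))"
      using k by (simp add: v_def scalar_prod_clause_vec sum_divide_distrib[symmetric] sum_distrib_left
          mult.assoc sum.swap[of _ "xor_assignments (\<phi> k)"])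
    also have "\<dots> = (\<Sum>b\<in>xor_assignments (\<phi> k). if b = a then v (k, a) \<bullet> v (k, a) else 0)"
      using orth[OF k k a] xor_assignments_contradicting[OF \<phi>[OF k] a] by (intro sum.cong) auto
    also have "\<dots> = v (k, a) \<bullet> v (k, a)" using fin a by simp
    finally show ?thesis by simp
  qed
  have unit: "v0 \<bullet> v0 = 1"
    using sum_coord[of 0 0] by (simp add: v0_def scalar_prod_def atLeast0LessThan del: sum.lessThan_Suc)
  have carrier: "v0 \<in> carrier_vec (Suc n)" "v i \<in> carrier_vec (Suc n)" for i
    by (auto simp: v0_def v_def clause_vec_def split: prod.splits)
  have "theta_feasible (xor_graph m \<phi>) (Suc n) v0 v"
    unfolding theta_feasible_def using carrier unit self nonneg orth
    by (auto simp: xor_graph_def Let_def)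
  moreover have "(\<Sum>i\<in>fst (xor_graph m \<phi>). v0 \<bullet> v i) = real m"
  proof -
    have "(\<Sum>a\<in>xor_assignments (\<phi> k). v0 \<bullet> v (k, a)) = 1" if k: "k < m" for k
    proof -
      have "(\<Sum>a\<in>xor_assignments (\<phi> k). v0 \<bullet> v (k, a)) = (\<Sum>a\<in>xor_assignments (\<phi> k). v (k, a) \<bullet> v0)"
        using carrier by (intro sum.cong refl comm_scalar_prod)
      also have "\<dots> = (\<Sum>a\<in>xor_assignments (\<phi> k). \<Sum>p\<in>Q k. sgn_of a p * corr p 0) / 4"
        using k by (simp add: v_def v0_def scalar_prod_clause_vec_zero sum_divide_distrib)
      also have "\<dots> = 1" using total[OF k] by simp
      finally show ?thesis .
    qed
    then show ?thesis using sum_xor_graph[where \<phi> = \<phi> and m = m and f = "\<lambda>i. v0 \<bullet> v i", OF \<phi>] by simp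
  qed
  ultimately have "\<exists>d v0 v. theta_feasible (xor_graph m \<phi>) d v0 v \<and>
      real m = (\<Sum>i\<in>fst (xor_graph m \<phi>). v0 \<bullet> v i)"
    by metis
  then show ?thesis
    unfolding lovasz_theta_def using theta_feasible_xor_graph_le[of m \<phi>, OF \<phi>]
    by (intro Greatest_equality) auto
qed

section \<open>Expansion\<close>

definition vars :: "(nat \<Rightarrow> clause) \<Rightarrow> nat set \<Rightarrow> nat set" where
  "vars \<phi> I = (\<Union>k\<in>I. fst ` \<phi> k)"

lemma clause_vars:
  assumes "C \<in> clauses n"
  shows "card (fst ` C) = 3" "fst ` C \<subseteq> {1..n}" "finite (fst ` C)"
proof -
  have "C \<subseteq> {1..n} \<times> UNIV" "card C = 3" "inj_on fst C" using assms by (auto simp: clauses_def)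
  then show "card (fst ` C) = 3" "fst ` C \<subseteq> {1..n}" by (auto simp: card_image)
  then show "finite (fst ` C)" using finite_subset by blast
qed

text \<open>Every variable that is not in the boundary occurs at least twice.\<close>

lemma two_card_vars_le:
  assumes \<phi>: "\<And>k. k \<in> I \<Longrightarrow> \<phi> k \<in> clauses n" and "finite I"
  shows "2 * card (vars \<phi> I) \<le>
    3 * card I + card {p. odd (card {k \<in> I. p \<in> insert 0 (fst ` \<phi> k)})}"
proof -
  define deg where "deg p = card {k \<in> I. p \<in> fst ` \<phi> k}" for p
  let ?D = "{p. odd (card {k \<in> I. p \<in> insert 0 (fst ` \<phi> k)})}"
  have fin: "finite (vars \<phi> I)" unfolding vars_def using \<phi> clause_vars(3) \<open>finite I\<close> by blast
  have pos: "0 \<notin> vars \<phi> I" unfolding vars_def using \<phi> clause_vars(2) by fastforce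
  have "?D \<subseteq> insert 0 (vars \<phi> I)"
  proof
    fix p assume "p \<in> ?D"
    then have "{k \<in> I. p \<in> insert 0 (fst ` \<phi> k)} \<noteq> {}" by (metis (mono_tags) card.empty even_zero mem_Collect_eq)
    then show "p \<in> insert 0 (vars \<phi> I)" unfolding vars_def by blast
  qed
  then have finD: "finite ?D" using fin finite_subset by blast
  have "(\<Sum>p\<in>vars \<phi> I. deg p) = (\<Sum>p\<in>vars \<phi> I. \<Sum>k\<in>I. if p \<in> fst ` \<phi> k then 1 else 0)"
    unfolding deg_def using \<open>finite I\<close> by (simp add: sum.If_cases Collect_conj_eq)
  also have "\<dots> = (\<Sum>k\<in>I. \<Sum>p\<in>vars \<phi> I. if p \<in> fst ` \<phi> k then 1 else 0)" by (rule sum.swap)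
  also have "\<dots> = (\<Sum>k\<in>I. 3)"
  proof (rule sum.cong[OF refl])
    fix k assume k: "k \<in> I"
    then have "vars \<phi> I \<inter> fst ` \<phi> k = fst ` \<phi> k" unfolding vars_def by blast
    then show "(\<Sum>p\<in>vars \<phi> I. if p \<in> fst ` \<phi> k then 1 else 0) = (3 :: nat)"
      using fin clause_vars(1)[OF \<phi>[OF k]] by (simp add: sum.If_cases)
  qed
  finally have total: "(\<Sum>p\<in>vars \<phi> I. deg p) = 3 * card I" by simp
  have "(\<Sum>p\<in>vars \<phi> I. 2) \<le> (\<Sum>p\<in>vars \<phi> I. deg p + (if p \<in> ?D then 1 else 0))"
  proof (rule sum_mono)
    fix p assume p: "p \<in> vars \<phi> I"
    then have "p \<noteq> 0" using pos by metis
    then have "p \<in> ?D \<longleftrightarrow> odd (deg p)" unfolding deg_def by simp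
    moreover have "deg p \<noteq> 0" unfolding deg_def using p \<open>finite I\<close> by (auto simp: vars_def)
    ultimately show "2 \<le> deg p + (if p \<in> ?D then 1 else 0)" by (cases "deg p = 1") auto
  qed
  also have "\<dots> = 3 * card I + card (vars \<phi> I \<inter> ?D)"
    using fin total by (simp add: sum.distrib sum.If_cases)
  \<comment> \<open>The boundary may also contain the point 0, which is not a variable.\<close>
  also have "\<dots> \<le> 3 * card I + card ?D" using finD by (intro add_left_mono card_mono) auto
  finally show ?thesis by simp
qed

text \<open>By \<open>two_card_vars_le\<close>, an empty boundary contradicts \<open>expand\<close>,
  and a boundary of at most two points contradicts \<open>expand'\<close> once \<open>card I\<close>
  exceeds \<open>L\<close>.\<close>

lemma parity_system_of_expansion:
  assumes \<phi>: "\<And>k. k < m \<Longrightarrow> \<phi> k \<in> clauses n"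
    and expand: "\<And>I. \<lbrakk>I \<subseteq> {..<m}; I \<noteq> {}; card I \<le> 2 * L + 2\<rbrakk> \<Longrightarrow> 3 * card I < 2 * card (vars \<phi> I)"
    and expand': "\<And>I. \<lbrakk>I \<subseteq> {..<m}; L < card I; card I \<le> 2 * L + 2\<rbrakk> \<Longrightarrow>
      3 * card I + 2 < 2 * card (vars \<phi> I)"
  shows "parity_system {..<m} (\<lambda>k. insert 0 (fst ` \<phi> k)) (\<lambda>k. rhs (\<phi> k)) L"
proof
  show "finite {..<m}" by simp
  show "rhs (\<phi> k) * rhs (\<phi> k) = 1" for k
    unfolding rhs_def prod.distrib[symmetric] by (intro prod.neutral) auto
  have bound: "2 * card (vars \<phi> I) \<le> 3 * card I + card {p. odd (card {k \<in> I. p \<in> insert 0 (fst ` \<phi> k)})}"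
    if "I \<subseteq> {..<m}" for I
    using that by (intro two_card_vars_le[of I \<phi> n] \<phi>) (auto intro: finite_subset)
  show "I = {}" if I: "I \<subseteq> {..<m}" "card I \<le> 2 * L + 2"
    "{p. odd (card {k \<in> I. p \<in> insert 0 (fst ` \<phi> k)})} = {}" for I
  proof (rule ccontr)
    assume "I \<noteq> {}"
    then show False using expand[OF I(1) _ I(2)] bound[OF I(1)] unfolding I(3) by simp
  qed
  show "card I \<le> L" if I: "I \<subseteq> {..<m}" "card I \<le> 2 * L + 2"
    "card {p. odd (card {k \<in> I. p \<in> insert 0 (fst ` \<phi> k)})} \<le> 2" for I
    using expand'[OF I(1) _ I(2)] bound[OF I(1)] I(3) by linarith
qed

section \<open>Random clauses\<close>

text \<open>A clause is encoded by the set \<open>Y\<close> of its three variables and the set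
  \<open>Z\<close> of those that occur unnegated, which accounts for the factor 8. A general
  \<open>X\<close> covers both the set of all clauses and the clauses inside a given set of
  variables.\<close>

lemma card_clauses_over:
  assumes "finite X"
  shows "card {C :: clause. C \<subseteq> X \<times> UNIV \<and> card C = 3 \<and> inj_on fst C} = 8 * (card X choose 3)"
proof -
  let ?S = "SIGMA Y:{Y. Y \<subseteq> X \<and> card Y = 3}. Pow Y"
  let ?f = "\<lambda>(Y, Z). (\<lambda>y. (y, y \<in> Z)) ` Y"
  let ?g = "\<lambda>C. (fst ` C, {y. (y, True) \<in> C})"
  let ?T = "{C :: clause. C \<subseteq> X \<times> UNIV \<and> card C = 3 \<and> inj_on fst C}"
  have "bij_betw ?f ?S ?T"
  proof (rule bij_betw_byWitness[where f' = ?g])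
    show "\<forall>a\<in>?S. ?g (?f a) = a" by (auto simp: image_image)
    show "\<forall>C\<in>?T. ?f (?g C) = C"
    proof
      fix C :: clause assume "C \<in> ?T"
      then have inj: "inj_on fst C" by blast
      have "(fst l, (fst l, True) \<in> C) = l" if "l \<in> C" for l
      proof (cases "snd l")
        case True
        then show ?thesis using that by (metis prod.collapse)
      next
        case False
        then have "(fst l, True) \<notin> C" using inj_onD[OF inj, of l "(fst l, True)"] that by (metis fst_conv snd_conv)
        then show ?thesis using False by (metis prod.collapse)
      qed
      then have "(\<lambda>l. (fst l, (fst l, True) \<in> C)) ` C = (\<lambda>l. l) ` C" by (intro image_cong) auto
      then show "?f (?g C) = C" by (simp add: image_image)
    qed
    show "?f ` ?S \<subseteq> ?T"
    proof
      fix C assume "C \<in> ?f ` ?S"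
      then obtain Y Z where YZ: "Y \<subseteq> X" "card Y = 3" "C = (\<lambda>y. (y, y \<in> Z)) ` Y" by auto
      have "inj_on (\<lambda>y. (y, y \<in> Z)) Y" by (auto simp: inj_on_def)
      then have "card C = 3" using YZ by (simp add: card_image)
      then show "C \<in> ?T" using YZ by (auto simp: inj_on_def)
    qed
    show "?g ` ?T \<subseteq> ?S"
    proof
      fix P assume "P \<in> ?g ` ?T"
      then obtain C where C: "C \<subseteq> X \<times> UNIV" "card C = 3" "inj_on fst C" "P = ?g C" by blast
      then have "fst ` C \<subseteq> X" "card (fst ` C) = 3" by (auto simp: card_image)
      moreover have "{y. (y, True) \<in> C} \<subseteq> fst ` C" by force
      ultimately show "P \<in> ?S" using C(4) by blast
    qed
  qed
  then have "card ?T = card ?S" by (simp add: bij_betw_same_card)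
  also have "\<dots> = (\<Sum>Y\<in>{Y. Y \<subseteq> X \<and> card Y = 3}. card (Pow Y))"
    using assms by (intro card_SigmaI) (auto intro: finite_subset)
  also have "\<dots> = (\<Sum>Y\<in>{Y. Y \<subseteq> X \<and> card Y = 3}. 8)"
    using assms by (intro sum.cong) (auto simp: card_Pow dest: finite_subset)
  finally show ?thesis using n_subsets[OF assms, of 3] by simp
qed

lemma finite_clauses: "finite (clauses n)"
  by (rule finite_subset[of _ "Pow ({1..n} \<times> UNIV)"]) (auto simp: clauses_def)

lemma card_clauses: "card (clauses n) = 8 * (n choose 3)"
  using card_clauses_over[of "{1..n}"] by (simp add: clauses_def)

lemma clauses_nonempty: "3 \<le> n \<Longrightarrow> clauses n \<noteq> {}"
  using card_clauses[of n] zero_less_binomial[of 3 n] by (metis card.empty mult_is_0 not_gr0 zero_neq_numeral)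

lemma choose_3_eq: "real (n choose 3) = real n * (real n - 1) * (real n - 2) / 6"
  by (simp add: binomial_gbinomial gbinomial_prod_rev numeral_3_eq_3 fact_reduce algebra_simps)

text \<open>Lowering numerator and denominator equally does not increase a fraction that is at most
  1, so each of the three factors is at most \<open>v / n\<close>. The proof has this
  cross-multiplied, with one more factor \<open>n\<close> on both sides to form
  \<open>n ^ 3\<close>.\<close>

lemma choose_3_ratio:
  assumes "v \<le> n" "3 \<le> n"
  shows "real (v choose 3) / real (n choose 3) \<le> (real v / real n) ^ 3"
proof (cases "v < 3")
  case True
  then show ?thesis by (simp add: binomial_eq_0)
next
  case False
  have "real v * ((real v - 1) * real n) * ((real v - 2) * real n) * real n \<le>
      real v * (real v * (real n - 1)) * (real v * (real n - 2)) * real n"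
  proof -
    have "(real v - 1) * real n \<le> real v * (real n - 1)" "(real v - 2) * real n \<le> real v * (real n - 2)"
      using assms(1) by (simp_all add: algebra_simps)
    then have "((real v - 1) * real n) * ((real v - 2) * real n) \<le>
        (real v * (real n - 1)) * (real v * (real n - 2))"
    proof (rule mult_mono)
      have "0 \<le> real v - 2" "0 \<le> real n - 1" using assms(2) False by linarith+
      then show "0 \<le> real v * (real n - 1)" "0 \<le> (real v - 2) * real n" by simp_all
    qed
    then show ?thesis
      unfolding mult.assoc[of "real v" "(real v - 1) * real n"]
        mult.assoc[of "real v" "real v * (real n - 1)"]
      by (intro mult_right_mono mult_left_mono) auto
  qed
  then have "(real v * (real v - 1) * (real v - 2)) * real n ^ 3 \<le>
      real v ^ 3 * (real n * (real n - 1) * (real n - 2))"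
    by (simp only: power3_eq_cube ac_simps)
  moreover have "real n * (real n - 1) * (real n - 2) > 0" using assms by simp
  ultimately show ?thesis using assms unfolding choose_3_eq power_divide
    by (simp add: divide_simps)
qed

lemma prob_clause_over:
  assumes "3 \<le> n" "X \<subseteq> {1..n}" "card X \<le> v"
  shows "measure_pmf.prob (pmf_of_set (clauses n)) {C. fst ` C \<subseteq> X} \<le> (real v / real n) ^ 3"
proof -
  have "finite X" using assms(2) finite_subset by blast
  have "card X \<le> n" using card_mono[OF _ assms(2)] by simp
  have "clauses n \<inter> {C. fst ` C \<subseteq> X} = {C :: clause. C \<subseteq> X \<times> UNIV \<and> card C = 3 \<and> inj_on fst C}"
    using assms(2) by (fastforce simp: clauses_def)
  then have "measure_pmf.prob (pmf_of_set (clauses n)) {C. fst ` C \<subseteq> X} =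
      real (card X choose 3) / real (n choose 3)"
    using card_clauses_over[OF \<open>finite X\<close>] finite_clauses clauses_nonempty[OF assms(1)]
    by (simp add: measure_pmf_of_set card_clauses)
  also have "\<dots> \<le> (real (card X) / real n) ^ 3" using choose_3_ratio[OF \<open>card X \<le> n\<close> assms(1)] .
  also have "\<dots> \<le> (real v / real n) ^ 3" using assms(3) by (intro power_mono divide_right_mono) auto
  finally show ?thesis .
qed

text \<open>The clauses are independent; those with index outside \<open>I\<close> are unrestricted
  and contribute factor 1.\<close>

lemma prob_subformula_over:
  assumes "3 \<le> n" "X \<subseteq> {1..n}" "card X \<le> v" "I \<subseteq> {..<m}"
  shows "measure_pmf.prob (random_3cnf n m) {\<phi>. \<forall>k\<in>I. fst ` \<phi> k \<subseteq> X} \<le> (real v / real n) ^ (3 * card I)"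
proof -
  let ?B = "\<lambda>k. if k \<in> I then {C. fst ` C \<subseteq> X} else (UNIV :: clause set)"
  have "{\<phi>. \<forall>k\<in>I. fst ` \<phi> k \<subseteq> X} = Pi {..<m} ?B" using assms(4) by (auto simp: Pi_def)
  then have "measure_pmf.prob (random_3cnf n m) {\<phi>. \<forall>k\<in>I. fst ` \<phi> k \<subseteq> X} =
      (\<Prod>k<m. measure_pmf.prob (pmf_of_set (clauses n)) (?B k))"
    unfolding random_3cnf_def by (simp add: measure_Pi_pmf_Pi)
  also have "\<dots> \<le> (\<Prod>k<m. if k \<in> I then (real v / real n) ^ 3 else 1)"
    using prob_clause_over[OF assms(1-3)] by (intro prod_mono) auto
  also have "\<dots> = ((real v / real n) ^ 3) ^ card I"
    using assms(4) by (simp add: prod.If_cases Int_absorb1)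
  finally show ?thesis by (simp add: power_mult)
qed

section \<open>Union bound over small sets of clauses with few variables\<close>

lemma random_3cnf_clauses:
  assumes "3 \<le> n" "\<phi> \<in> set_pmf (random_3cnf n m)" "k < m"
  shows "\<phi> k \<in> clauses n"
  using assms finite_clauses clauses_nonempty[OF assms(1)]
  by (auto simp: random_3cnf_def set_Pi_pmf PiE_dflt_def)

text \<open>Padding by repetition lets lists of length exactly \<open>v\<close> stand for all
  nonempty sets of at most \<open>v\<close> variables, so that \<open>n ^ v\<close> candidates
  suffice in the union bound.\<close>

lemma ex_list_cover:
  assumes "finite X" "X \<noteq> {}" "card X \<le> v"
  obtains xs where "set xs = X" "length xs = v"
proof -
  obtain ys where ys: "set ys = X" "distinct ys" using finite_distinct_list[OF assms(1)] by blast
  obtain x where "x \<in> X" using assms(2) by blast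
  then have "set (ys @ replicate (v - card X) x) = X" using ys by auto
  moreover have "length (ys @ replicate (v - card X) x) = v" using ys assms(3) by (auto simp: distinct_card[symmetric])
  ultimately show thesis by (rule that)
qed

text \<open>Union bound over the index set \<open>I\<close> and a list \<open>xs\<close> that covers
  its variables. The three factors bound the number of lists, the number of index sets and the
  probability for one such pair. Restricting to the support ensures that every
  \<open>\<phi> k\<close> is a clause.\<close>

lemma prob_few_vars:
  assumes n: "3 \<le> n" and s: "0 < s"
  shows "measure_pmf.prob (random_3cnf n m)
      {\<phi> \<in> set_pmf (random_3cnf n m). \<exists>I\<subseteq>{..<m}. card I = s \<and> card (vars \<phi> I) \<le> v}
    \<le> real n ^ v * real m ^ s * (real v / real n) ^ (3 * s)"
proof -
  let ?Is = "{I. I \<subseteq> {..<m} \<and> card I = s}"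
  let ?xs = "{xs. set xs \<subseteq> {1..n} \<and> length xs = v}"
  let ?E = "\<lambda>(I, xs). {\<phi> :: nat \<Rightarrow> clause. \<forall>k\<in>I. fst ` \<phi> k \<subseteq> set xs}"
  have fin: "finite ?Is" "finite ?xs" using finite_lists_length_eq[of "{1..n}" v] by auto
  have "{\<phi> \<in> set_pmf (random_3cnf n m). \<exists>I\<subseteq>{..<m}. card I = s \<and> card (vars \<phi> I) \<le> v}
      \<subseteq> (\<Union>p\<in>?Is \<times> ?xs. ?E p)"
  proof
    fix \<phi> assume "\<phi> \<in> {\<phi> \<in> set_pmf (random_3cnf n m). \<exists>I\<subseteq>{..<m}. card I = s \<and> card (vars \<phi> I) \<le> v}"
    then obtain I where \<phi>: "\<phi> \<in> set_pmf (random_3cnf n m)" and I: "I \<subseteq> {..<m}" "card I = s"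
      "card (vars \<phi> I) \<le> v" by blast
    have c: "\<phi> k \<in> clauses n" if "k \<in> I" for k using random_3cnf_clauses[OF n \<phi>] that I(1) by blast
    have "finite I" "I \<noteq> {}" using I(2) s by (auto intro: card_ge_0_finite)
    have sub: "vars \<phi> I \<subseteq> {1..n}" unfolding vars_def using clause_vars(2)[OF c] by blast
    have "vars \<phi> I \<noteq> {}"
    proof -
      obtain k where k: "k \<in> I" using \<open>I \<noteq> {}\<close> by blast
      then have "fst ` \<phi> k \<noteq> {}" using clause_vars(1)[OF c[OF k]] by (metis card.empty zero_neq_numeral)
      then show ?thesis using k unfolding vars_def by blast
    qed
    then obtain xs where xs: "set xs = vars \<phi> I" "length xs = v"
      using ex_list_cover[of "vars \<phi> I" v] I(3) finite_subset[OF sub] by blast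
    then have "(I, xs) \<in> ?Is \<times> ?xs" using I sub by simp
    moreover have "\<phi> \<in> ?E (I, xs)" using xs(1) by (auto simp: vars_def)
    ultimately show "\<phi> \<in> (\<Union>p\<in>?Is \<times> ?xs. ?E p)" by blast
  qed
  then have "measure_pmf.prob (random_3cnf n m)
      {\<phi> \<in> set_pmf (random_3cnf n m). \<exists>I\<subseteq>{..<m}. card I = s \<and> card (vars \<phi> I) \<le> v}
      \<le> measure_pmf.prob (random_3cnf n m) (\<Union>p\<in>?Is \<times> ?xs. ?E p)"
    by (intro measure_pmf.finite_measure_mono) auto
  also have "\<dots> \<le> (\<Sum>p\<in>?Is \<times> ?xs. measure_pmf.prob (random_3cnf n m) (?E p))"
    using fin by (intro measure_UNION_le) auto
  also have "\<dots> \<le> (\<Sum>p\<in>?Is \<times> ?xs. (real v / real n) ^ (3 * s))"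
  proof (rule sum_mono)
    fix p assume "p \<in> ?Is \<times> ?xs"
    then obtain I xs where p: "p = (I, xs)" "I \<subseteq> {..<m}" "card I = s" "set xs \<subseteq> {1..n}" "length xs = v"
      by blast
    then show "measure_pmf.prob (random_3cnf n m) (?E p) \<le> (real v / real n) ^ (3 * s)"
      using prob_subformula_over[OF n p(4) _ p(2), of v] card_length[of xs] by simp
  qed
  also have "\<dots> = real (m choose s) * real n ^ v * (real v / real n) ^ (3 * s)"
    using n_subsets[of "{..<m}" s] card_lists_length_eq[of "{1..n}" v] by (simp add: card_cartesian_product)
  also have "\<dots> \<le> real m ^ s * real n ^ v * (real v / real n) ^ (3 * s)"
  proof -
    have "m choose s \<le> m ^ s"
      by (cases "s \<le> m") (simp_all add: binomial_le_pow binomial_eq_0)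
    then have "real (m choose s) \<le> real m ^ s" by (metis of_nat_le_iff of_nat_power)
    then show ?thesis by (intro mult_right_mono) auto
  qed
  finally show ?thesis by (simp add: mult.commute)
qed

text \<open>The cases \<open>i = j = 0\<close> and \<open>i = j = 1\<close> are the two terms of the union bound.\<close>

lemma few_vars_term_le:
  assumes n: "0 < n" and K: "s \<le> K" "2 \<le> K" and i: "i \<le> 1"
  shows "real n ^ (3 * s div 2 + j) * real m ^ s * (real (3 * s div 2 + i) / real n) ^ (3 * s)
    \<le> real n ^ j * (8 * real K ^ 3 * real m / real n powr (3/2)) ^ s"
proof -
  have "real n ^ (3 * s div 2) = real n powr real (3 * s div 2)" using n by (simp add: powr_realpow)
  also have "\<dots> \<le> real n powr (3/2 * real s)"
    using n by (intro powr_mono) (auto simp: field_simps real_of_nat_div)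
  also have "\<dots> = (real n powr (3/2)) ^ s" using n powr_realpow[of "real n powr (3/2)" s] by (simp add: powr_powr)
  finally have a: "real n ^ (3 * s div 2) \<le> (real n powr (3/2)) ^ s" .
  \<comment> \<open>\<open>2 \<le> K\<close> gives \<open>3/2 * K + 1 \<le> 2 * K\<close>.\<close>
  have "real (3 * s div 2 + i) \<le> 2 * real K" using K i by linarith
  then have "(real (3 * s div 2 + i) / real n) ^ 3 \<le> (2 * real K / real n) ^ 3"
    by (intro power_mono divide_right_mono) auto
  \<comment> \<open>\<open>n ^ 3\<close> is split in two: one half cancels the count of lists, the
    other remains as the denominator under \<open>m\<close>.\<close>
  also have "\<dots> = 8 * real K ^ 3 / (real n powr (3/2) * real n powr (3/2))"
    using n by (simp add: power_divide power_mult_distrib powr_add[symmetric] powr_numeral)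
  finally have b: "(real (3 * s div 2 + i) / real n) ^ 3 \<le> 8 * real K ^ 3 / (real n powr (3/2) * real n powr (3/2))" .
  have "real n ^ (3 * s div 2 + j) * real m ^ s * (real (3 * s div 2 + i) / real n) ^ (3 * s)
     = real n ^ j * (real n ^ (3 * s div 2) * real m ^ s * ((real (3 * s div 2 + i) / real n) ^ 3) ^ s)"
    by (simp add: power_add power_mult)
  also have "\<dots> \<le> real n ^ j * ((real n powr (3/2)) ^ s * real m ^ s *
      (8 * real K ^ 3 / (real n powr (3/2) * real n powr (3/2))) ^ s)"
    using a b by (intro mult_left_mono mult_mono power_mono) auto
  also have "\<dots> = real n ^ j * (8 * real K ^ 3 * real m / real n powr (3/2)) ^ s"
    using n unfolding power_mult_distrib[symmetric] by (simp add: field_simps)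
  finally show ?thesis .
qed

text \<open>Having at most \<open>3 * s / 2\<close> variables on some \<open>s\<close> clauses has
  probability at most \<open>\<epsilon> ^ s\<close>. Allowing one more variable costs a factor
  \<open>n\<close>, which \<open>\<epsilon> ^ L\<close> absorbs for \<open>s > L\<close>, leaving a
  factor \<open>\<epsilon>\<close>. Each of the at most \<open>2 * K\<close> events thus has
  probability at most \<open>\<epsilon>\<close>.\<close>

lemma prob_lovasz_theta_ge:
  fixes n m L :: nat
  defines "K \<equiv> 2 * L + 2"
  defines "\<epsilon> \<equiv> 8 * real K ^ 3 * real m / real n powr (3/2)"
  assumes n: "3 \<le> n" and \<epsilon>: "\<epsilon> \<le> 1" "real n * \<epsilon> ^ L \<le> 1"
  shows "measure_pmf.prob (random_3cnf n m) {\<phi>. lovasz_theta (xor_graph m \<phi>) = real m} \<ge> 1 - 2 * real K * \<epsilon>"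
proof -
  let ?M = "random_3cnf n m"
  let ?bad = "\<lambda>s v. {\<phi> \<in> set_pmf ?M. \<exists>I\<subseteq>{..<m}. card I = s \<and> card (vars \<phi> I) \<le> v}"
  \<comment> \<open>In integers, at most \<open>3 * s div 2\<close> variables means the failure of
    \<open>3 * s < 2 * card (vars \<phi> I)\<close>, and at most \<open>3 * s div 2 + 1\<close> that
    of \<open>3 * s + 2 < 2 * card (vars \<phi> I)\<close>.\<close>
  let ?B = "(\<Union>s\<in>{1..K}. ?bad s (3 * s div 2)) \<union> (\<Union>s\<in>{Suc L..K}. ?bad s (3 * s div 2 + 1))"
  have \<epsilon>0: "0 \<le> \<epsilon>" unfolding \<epsilon>_def by simp
  have "measure_pmf.prob ?M ?B \<le> measure_pmf.prob ?M (\<Union>s\<in>{1..K}. ?bad s (3 * s div 2)) +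
      measure_pmf.prob ?M (\<Union>s\<in>{Suc L..K}. ?bad s (3 * s div 2 + 1))"
    by (intro measure_Un_le) auto
  also have "measure_pmf.prob ?M (\<Union>s\<in>{1..K}. ?bad s (3 * s div 2)) \<le> real K * \<epsilon>"
  proof -
    have "measure_pmf.prob ?M (\<Union>s\<in>{1..K}. ?bad s (3 * s div 2)) \<le>
        (\<Sum>s\<in>{1..K}. measure_pmf.prob ?M (?bad s (3 * s div 2)))"
      by (intro measure_UNION_le) auto
    also have "\<dots> \<le> (\<Sum>s\<in>{1..K}. \<epsilon>)"
    proof (rule sum_mono)
      fix s assume s: "s \<in> {1..K}"
      have "measure_pmf.prob ?M (?bad s (3 * s div 2)) \<le> \<epsilon> ^ s"
        using prob_few_vars[OF n, of s m "3 * s div 2"] few_vars_term_le[of n s K 0 0 m] s n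
        by (simp add: \<epsilon>_def K_def)
      also have "\<dots> \<le> \<epsilon>" using power_decreasing[of 1 s \<epsilon>] s \<epsilon>(1) \<epsilon>0 by simp
      finally show "measure_pmf.prob ?M (?bad s (3 * s div 2)) \<le> \<epsilon>" .
    qed
    finally show ?thesis by simp
  qed
  also have "measure_pmf.prob ?M (\<Union>s\<in>{Suc L..K}. ?bad s (3 * s div 2 + 1)) \<le> real K * \<epsilon>"
  proof -
    have "measure_pmf.prob ?M (\<Union>s\<in>{Suc L..K}. ?bad s (3 * s div 2 + 1)) \<le>
        (\<Sum>s\<in>{Suc L..K}. measure_pmf.prob ?M (?bad s (3 * s div 2 + 1)))"
      by (intro measure_UNION_le) auto
    also have "\<dots> \<le> (\<Sum>s\<in>{Suc L..K}. \<epsilon>)"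
    proof (rule sum_mono)
      fix s assume s: "s \<in> {Suc L..K}"
      have "measure_pmf.prob ?M (?bad s (3 * s div 2 + 1)) \<le> real n * \<epsilon> ^ s"
        using order_trans[OF prob_few_vars[OF n, of s m "3 * s div 2 + 1"] few_vars_term_le[of n s K 1 1 m]] s n
        unfolding \<epsilon>_def by (simp add: K_def)
      also have "\<dots> \<le> real n * \<epsilon> ^ Suc L"
        using power_decreasing[of "Suc L" s \<epsilon>] s \<epsilon>(1) \<epsilon>0 by (intro mult_left_mono) auto
      also have "\<dots> = (real n * \<epsilon> ^ L) * \<epsilon>" by simp
      also have "\<dots> \<le> 1 * \<epsilon>" using \<epsilon>(2) \<epsilon>0 by (intro mult_right_mono)
      finally show "measure_pmf.prob ?M (?bad s (3 * s div 2 + 1)) \<le> \<epsilon>" by simp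
    qed
    also have "\<dots> \<le> real K * \<epsilon>" using \<epsilon>0 by (simp add: mult_right_mono)
    finally show ?thesis .
  qed
  finally have bad: "measure_pmf.prob ?M ?B \<le> 2 * real K * \<epsilon>" by linarith
  have good: "lovasz_theta (xor_graph m \<phi>) = real m" if \<phi>: "\<phi> \<in> set_pmf ?M" "\<phi> \<notin> ?B" for \<phi>
  proof (rule lovasz_theta_xor_graph)
    show c: "\<phi> k \<in> clauses n" if "k < m" for k using random_3cnf_clauses[OF n \<phi>(1) that] .
    show "parity_system {..<m} (\<lambda>k. insert 0 (fst ` \<phi> k)) (\<lambda>k. rhs (\<phi> k)) L"
    proof (rule parity_system_of_expansion[OF c])
      fix I assume I: "I \<subseteq> {..<m}" "I \<noteq> {}" "card I \<le> 2 * L + 2"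
      have "card I \<noteq> 0" using I finite_subset[OF I(1)] by simp
      then have "card I \<in> {1..K}" using I(3) by (simp add: K_def)
      then have "\<not> card (vars \<phi> I) \<le> 3 * card I div 2" using \<phi> I(1) by blast
      then show "3 * card I < 2 * card (vars \<phi> I)" by linarith
    next
      fix I assume I: "I \<subseteq> {..<m}" "L < card I" "card I \<le> 2 * L + 2"
      then have "card I \<in> {Suc L..K}" by (simp add: K_def)
      then have "\<not> card (vars \<phi> I) \<le> 3 * card I div 2 + 1" using \<phi> I(1) by blast
      then show "3 * card I + 2 < 2 * card (vars \<phi> I)" by linarith
    qed
  qed
  have "1 - measure_pmf.prob ?M ?B = measure_pmf.prob ?M (- ?B)"
    using measure_pmf.prob_compl[of ?B ?M] by (simp add: Compl_eq_Diff_UNIV)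
  also have "\<dots> = measure_pmf.prob ?M (- ?B \<inter> set_pmf ?M)" by (simp add: measure_Int_set_pmf)
  also have "\<dots> \<le> measure_pmf.prob ?M {\<phi>. lovasz_theta (xor_graph m \<phi>) = real m}"
    using good by (intro measure_pmf.finite_measure_mono) auto
  finally show ?thesis using bad by linarith
qed

section \<open>Asymptotics for logarithmic \<open>L\<close>\<close>

theorem theorem2p1:
  fixes m :: "nat \<Rightarrow> nat"
  assumes "(\<lambda>n. real (m n)) \<in> o(\<lambda>n. real n powr (3 / 2 - 22 * ln (ln (real n)) / ln (real n)))"
  shows "(\<lambda>n. measure_pmf.prob (random_3cnf n (m n))
           {\<phi>. lovasz_theta (xor_graph (m n) \<phi>) = real (m n)}) \<longlonglongrightarrow> 1"
proof (rule tendsto_sandwich)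
  \<comment> \<open>With this choice, \<open>\<epsilon> n \<le> exp (-1)\<close> implies
    \<open>\<epsilon> n ^ L n \<le> exp (- L n) \<le> 1 / n\<close>.\<close>
  define L where "L n = nat \<lceil>ln (real n)\<rceil>" for n
  define \<epsilon> where "\<epsilon> n = 8 * real (2 * L n + 2) ^ 3 * real (m n) / real n powr (3/2)" for n
  \<comment> \<open>An eventual bound on \<open>(2 * L n + 2) * \<epsilon> n\<close>: the base of
    the fourth power bounds \<open>2 * L n + 2\<close>, and the last factor bounds
    \<open>m n / n powr (3/2)\<close>.\<close>
  define g where "g n = 8 * (2 * ln (real n) + 4) ^ 4 * ln (real n) powr (-22)" for n :: nat
  have g: "g \<longlonglongrightarrow> 0" unfolding g_def by real_asymp
  have big: "\<forall>\<^sub>F n :: nat in sequentially. 3 \<le> n \<and> 1 \<le> ln (real n)"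
  proof -
    have "\<forall>\<^sub>F n :: nat in sequentially. 1 \<le> ln (real n)" by real_asymp
    then show ?thesis using eventually_ge_at_top[of 3] by eventually_elim simp
  qed
  have m: "\<forall>\<^sub>F n in sequentially. real (m n) \<le> real n powr (3 / 2 - 22 * ln (ln (real n)) / ln (real n))"
    using landau_o.smallD[OF assms, of 1] by simp
  have \<epsilon>_le: "\<forall>\<^sub>F n in sequentially. real (2 * L n + 2) * \<epsilon> n \<le> g n"
    using big m
  proof eventually_elim
    case (elim n)
    then have n: "3 \<le> n" and l: "1 \<le> ln (real n)"
      and mn: "real (m n) \<le> real n powr (3 / 2 - 22 * ln (ln (real n)) / ln (real n))" by auto
    have "real n powr (3 / 2 - 22 * ln (ln (real n)) / ln (real n)) =
        real n powr (3/2) * real n powr (- (22 * ln (ln (real n)) / ln (real n)))"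
      by (simp add: powr_add[symmetric])
    \<comment> \<open>Both sides are \<open>exp (- 22 * ln (ln n))\<close>, as the denominator
      cancels the logarithm of the base.\<close>
    also have "real n powr (- (22 * ln (ln (real n)) / ln (real n))) = ln (real n) powr (-22)"
      using n l by (simp add: powr_def)
    finally have "real (m n) / real n powr (3/2) \<le> ln (real n) powr (-22)"
      using mn n by (simp add: field_simps)
    moreover have "real (2 * L n + 2) \<le> 2 * ln (real n) + 4"
      using l unfolding L_def by linarith
    ultimately have "8 * real (2 * L n + 2) ^ 4 * (real (m n) / real n powr (3/2)) \<le> g n"
      unfolding g_def by (intro mult_mono power_mono) auto
    moreover have "k * (8 * k ^ 3 * x / d) = 8 * k ^ 4 * (x / d)" for k x d :: real
      by (simp add: power4_eq_xxxx power3_eq_cube)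
    ultimately show ?case unfolding \<epsilon>_def by metis
  qed
  show "\<forall>\<^sub>F n in sequentially. 1 - 2 * g n \<le> measure_pmf.prob (random_3cnf n (m n))
           {\<phi>. lovasz_theta (xor_graph (m n) \<phi>) = real (m n)}"
  proof -
    have "\<forall>\<^sub>F n in sequentially. g n < exp (-1)"
      using order_tendstoD(2)[OF g, of "exp (-1)"] by simp
    then show ?thesis using big \<epsilon>_le
    proof eventually_elim
      case (elim n)
      have \<epsilon>0: "0 \<le> \<epsilon> n" unfolding \<epsilon>_def by simp
      have "\<epsilon> n \<le> real (2 * L n + 2) * \<epsilon> n" using mult_right_mono[of 1 "real (2 * L n + 2)" "\<epsilon> n"] \<epsilon>0 by simp
      then have e: "\<epsilon> n \<le> exp (-1)" using elim by linarith
      have "ln (real n) \<le> real (L n)" unfolding L_def by linarith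
      then have "real n \<le> exp (real (L n))" using elim by (metis exp_le_cancel_iff exp_ln of_nat_0_less_iff
        less_le_trans zero_less_numeral)
      moreover have "\<epsilon> n ^ L n \<le> exp (-1) ^ L n" using e \<epsilon>0 by (intro power_mono)
      moreover have "exp (-1) ^ L n = exp (- real (L n))" by (simp add: exp_of_nat_mult[symmetric])
      ultimately have "real n * \<epsilon> n ^ L n \<le> exp (real (L n)) * exp (- real (L n))"
        using \<epsilon>0 by (intro mult_mono) auto
      then have "real n * \<epsilon> n ^ L n \<le> 1" by (simp add: exp_add[symmetric])
      moreover have "\<epsilon> n \<le> 1" using e exp_le_cancel_iff[of "-1 :: real" 0] by (simp add: order_trans)
      ultimately show ?case
        using prob_lovasz_theta_ge[of n "L n" "m n"] elim unfolding \<epsilon>_def by linarith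
    qed
  qed
  show "\<forall>\<^sub>F n in sequentially. measure_pmf.prob (random_3cnf n (m n))
           {\<phi>. lovasz_theta (xor_graph (m n) \<phi>) = real (m n)} \<le> 1"
    by simp
  show "(\<lambda>n. 1 - 2 * g n) \<longlonglongrightarrow> 1" using tendsto_diff[OF tendsto_const[of 1] tendsto_mult_left[OF g, of 2]] by simp
qed simp

end
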